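(* Let $p$ be a prime, $l\ge1$ an integer, and let $f\in\mathbb{Q}_p[X]$ be a nonzero polynomial. Let $\mathcal{R}_f\subset\mathbb{Z}_p$ be the set of roots of $f$ in $\mathbb{Z}_p$. Then the sequence $(\mathcal{L}_{p^l}(f(n)))_{n\ge0}$ of elements of $\mathbb{Z}_p$ is (a) $k$-regular for every integer $k\ge2$ if $\mathcal{R}_f=\varnothing$; (b) strictly $p$-regular if $\varnothing\neq\mathcal{R}_f\subset\mathbb{Q}$; (c) not regular if $\mathcal{R}_f\not\subset\mathbb{Q}$. In particular, these conditions do not depend on $l$.
   Context: $\mathbb{N}=\{0,1,2,\ldots\}$. For nonzero $x\in\mathbb{Q}_p$ put $\nu_{p^l}(x)=\lfloor\nu_p(x)/l\rfloor$ and $\mathcal{L}_{p^l}(x)=p^{-l\,\nu_{p^l}(x)}x\in\mathbb{Z}_p$; put $\mathcal{L}_{p^l}(0)=0$. For an integer $k\ge2$, the $k$-kernel of $\mathbf{a}=(a_n)_{n\ge0}$ is $\{(a_{k^in+j})_{n\ge0}: i\ge0,\ 0\le j\le k^i-1\}$. A sequence with values in a $\mathbb{Z}$-module $R$ is $k$-regular if the $\mathbb{Z}$-submodule of $R^{\mathbb{N}}$ generated by its $k$-kernel is finitely generated. It is regular if it is $k$-regular for some $k\ge2$. It is strictly $k$-regular if it is $k$-regular and is not $m$-regular for any integer $m\ge2$ multiplicatively independent of $k$ (i.e. with $k^a\neq m^c$ for all integers $a,c\ge1$). *)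

theory Defs
  imports
    "HOL-Computational_Algebra.Polynomial_Factorial"
    "HOL-Library.Function_Algebras"
    "Berlekamp_Zassenhaus.Finite_Field"
begin

section \<open>The $p$-adic integers\<close>

text \<open>
  The prime is the cardinality of the type argument, \<open>p = CARD('p)\<close>. A $p$-adic integer
  is an element of the inverse limit of the rings of integers modulo $p^n$, represented by its
  least nonnegative residues modulo $p^0, p^1, p^2, \ldots$
\<close>

typedef (overloaded) 'p padic_int =
  "{x :: nat \<Rightarrow> int. \<forall>n. x n \<in> {0..<int CARD('p::prime_card) ^ n} \<and>
      x (Suc n) mod int CARD('p) ^ n = x n}"
  by (rule exI[of _ "\<lambda>_. 0"]) (simp add: prime_gt_0_nat[OF prime_card])

setup_lifting type_definition_padic_int

lemma CARD_prime_card_gt_1: "1 < CARD('p::prime_card)"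
  by (rule prime_gt_1_nat[OF prime_card])

lemma CARD_prime_card_pos [simp]: "0 < CARD('p::prime_card)"
  by (rule prime_gt_0_nat[OF prime_card])

lemma int_CARD_power_pos [simp]: "0 < int CARD('p::prime_card) ^ n"
  by simp

lemma mod_power_Suc_mod: "(a :: int) mod (q ^ Suc n) mod (q ^ n) = a mod q ^ n"
  by (rule mod_mod_cancel) simp

instantiation padic_int :: (prime_card) comm_ring_1
begin

lift_definition zero_padic_int :: "'a padic_int" is "\<lambda>_. 0"
  by simp

lift_definition one_padic_int :: "'a padic_int" is "\<lambda>n. 1 mod int CARD('a) ^ n"
  by (simp add: mod_power_Suc_mod del: power_Suc)

lift_definition plus_padic_int :: "'a padic_int \<Rightarrow> 'a padic_int \<Rightarrow> 'a padic_int"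
  is "\<lambda>x y n. (x n + y n) mod int CARD('a) ^ n"
proof (intro conjI)
  fix x y :: "nat \<Rightarrow> int" and n
  assume x: "\<And>n. x n \<in> {0..<int CARD('a) ^ n} \<and> x (Suc n) mod int CARD('a) ^ n = x n"
    and y: "\<And>n. y n \<in> {0..<int CARD('a) ^ n} \<and> y (Suc n) mod int CARD('a) ^ n = y n"
  show "(x n + y n) mod int CARD('a) ^ n \<in> {0..<int CARD('a) ^ n}" by simp
  show "(x (Suc n) + y (Suc n)) mod int CARD('a) ^ Suc n mod int CARD('a) ^ n
      = (x n + y n) mod int CARD('a) ^ n"
    unfolding mod_power_Suc_mod
    by (rule mod_add_cong) (use x y in \<open>simp_all add: mod_pos_pos_trivial\<close>)
qed

lift_definition uminus_padic_int :: "'a padic_int \<Rightarrow> 'a padic_int"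
  is "\<lambda>x n. (- x n) mod int CARD('a) ^ n"
proof (intro conjI)
  fix x :: "nat \<Rightarrow> int" and n
  assume x: "\<And>n. x n \<in> {0..<int CARD('a) ^ n} \<and> x (Suc n) mod int CARD('a) ^ n = x n"
  show "(- x n) mod int CARD('a) ^ n \<in> {0..<int CARD('a) ^ n}" by simp
  show "(- x (Suc n)) mod int CARD('a) ^ Suc n mod int CARD('a) ^ n
      = (- x n) mod int CARD('a) ^ n"
    unfolding mod_power_Suc_mod
    by (rule mod_minus_cong) (use x in \<open>simp add: mod_pos_pos_trivial\<close>)
qed

lift_definition times_padic_int :: "'a padic_int \<Rightarrow> 'a padic_int \<Rightarrow> 'a padic_int"
  is "\<lambda>x y n. (x n * y n) mod int CARD('a) ^ n"
proof (intro conjI)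
  fix x y :: "nat \<Rightarrow> int" and n
  assume x: "\<And>n. x n \<in> {0..<int CARD('a) ^ n} \<and> x (Suc n) mod int CARD('a) ^ n = x n"
    and y: "\<And>n. y n \<in> {0..<int CARD('a) ^ n} \<and> y (Suc n) mod int CARD('a) ^ n = y n"
  show "(x n * y n) mod int CARD('a) ^ n \<in> {0..<int CARD('a) ^ n}" by simp
  show "(x (Suc n) * y (Suc n)) mod int CARD('a) ^ Suc n mod int CARD('a) ^ n
      = (x n * y n) mod int CARD('a) ^ n"
    unfolding mod_power_Suc_mod
    by (rule mod_mult_cong) (use x y in \<open>simp_all add: mod_pos_pos_trivial\<close>)
qed

definition minus_padic_int :: "'a padic_int \<Rightarrow> 'a padic_int \<Rightarrow> 'a padic_int"
  where "x - y = x + - (y :: 'a padic_int)"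

instance
proof
  fix a b c :: "'a padic_int"
  show "a * b * c = a * (b * c)"
    by transfer (simp add: fun_eq_iff mod_simps mult.assoc)
  show "a * b = b * a"
    by transfer (simp add: fun_eq_iff mult.commute)
  show "1 * a = a"
    by transfer (simp add: fun_eq_iff mod_simps)
  show "a + b + c = a + (b + c)"
    by transfer (simp add: fun_eq_iff mod_simps add.assoc)
  show "a + b = b + a"
    by transfer (simp add: fun_eq_iff add.commute)
  show "0 + a = a"
    by transfer (simp add: fun_eq_iff)
  show "- a + a = 0"
    by transfer (simp add: fun_eq_iff mod_simps)
  show "a - b = a + - b"
    by (rule minus_padic_int_def)
  show "(a + b) * c = a * c + b * c"
    by transfer (simp add: fun_eq_iff mod_simps algebra_simps)
  have "1 mod int CARD('a) ^ 1 \<noteq> 0"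
    using CARD_prime_card_gt_1[where 'p='a] by simp
  then show "(0 :: 'a padic_int) \<noteq> 1"
    by transfer (metis)
qed

end

lemma Rep_padic_int_range:
  "0 \<le> Rep_padic_int (x :: 'p::prime_card padic_int) n" "Rep_padic_int x n < int CARD('p) ^ n"
  using Rep_padic_int[of x] by auto

lemma Rep_padic_int_mod:
  fixes x :: "'p::prime_card padic_int"
  assumes "n \<le> m"
  shows "Rep_padic_int x m mod int CARD('p) ^ n = Rep_padic_int x n"
  using assms
proof (induction m rule: dec_induct)
  case base
  then show ?case using Rep_padic_int_range[of x] by simp
next
  case (step m)
  have "Rep_padic_int x (Suc m) mod int CARD('p) ^ n
      = Rep_padic_int x (Suc m) mod int CARD('p) ^ m mod int CARD('p) ^ n"
    by (rule mod_mod_cancel[symmetric]) (use step in \<open>simp add: le_imp_power_dvd\<close>)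
  also have "Rep_padic_int x (Suc m) mod int CARD('p) ^ m = Rep_padic_int x m"
    using Rep_padic_int[of x] by auto
  finally show ?case using step.IH by simp
qed

lemma Rep_padic_int_of_nat:
  "Rep_padic_int (of_nat k :: 'p::prime_card padic_int) n = int k mod int CARD('p) ^ n"
  by (induction k)
    (simp_all add: zero_padic_int.rep_eq one_padic_int.rep_eq plus_padic_int.rep_eq mod_simps)

lemma padic_int_nonzeroE:
  assumes "(x :: 'p::prime_card padic_int) \<noteq> 0"
  obtains n where "\<And>m. n \<le> m \<Longrightarrow> \<not> int CARD('p) ^ n dvd Rep_padic_int x m"
proof -
  obtain n where "Rep_padic_int x n \<noteq> 0"
    using assms by (metis Rep_padic_int_inject ext zero_padic_int.rep_eq)
  then show ?thesis
    using that[of n] Rep_padic_int_mod[of n _ x] by (metis dvd_imp_mod_0)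
qed

instance padic_int :: (prime_card) idom
proof
  fix x y :: "'a padic_int"
  assume "x \<noteq> 0" "y \<noteq> 0"
  then obtain n m where n: "\<And>k. n \<le> k \<Longrightarrow> \<not> int CARD('a) ^ n dvd Rep_padic_int x k"
    and m: "\<And>k. m \<le> k \<Longrightarrow> \<not> int CARD('a) ^ m dvd Rep_padic_int y k"
    by (metis padic_int_nonzeroE)
  let ?p = "int CARD('a)" and ?a = "Rep_padic_int x (n + m)" and ?b = "Rep_padic_int y (n + m)"
  have p: "prime_elem ?p" by (rule prime_imp_prime_elem[OF prime_card_int])
  have nd: "\<not> ?p ^ n dvd ?a" "\<not> ?p ^ m dvd ?b" using n[of "n + m"] m[of "n + m"] by auto
  then have nz: "?a \<noteq> 0" "?b \<noteq> 0" by auto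
  have "multiplicity ?p ?a < n" "multiplicity ?p ?b < m"
    using nd multiplicity_dvd' by (metis not_less)+
  then have "multiplicity ?p (?a * ?b) < n + m"
    using prime_elem_multiplicity_mult_distrib[OF p nz] by simp
  moreover have "\<not> is_unit ?p" using CARD_prime_card_gt_1[where 'p='a] by simp
  ultimately have "\<not> ?p ^ (n + m) dvd ?a * ?b"
    using nz multiplicity_geI[of "?a * ?b" ?p "n + m"] by auto
  then have "Rep_padic_int (x * y) (n + m) \<noteq> Rep_padic_int 0 (n + m)"
    by (auto simp: times_padic_int.rep_eq zero_padic_int.rep_eq mod_eq_0_iff_dvd)
  then show "x * y \<noteq> 0" by metis
qed

instance padic_int :: (prime_card) ring_char_0
proof
  show "inj (of_nat :: nat \<Rightarrow> 'a padic_int)"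
  proof (rule injI)
    fix a b :: nat
    assume eq: "(of_nat a :: 'a padic_int) = of_nat b"
    let ?n = "Suc (a + b)"
    have "a + b < 2 ^ ?n" using less_exp[of ?n] by linarith
    also have "(2::nat) ^ ?n \<le> CARD('a) ^ ?n"
      using CARD_prime_card_gt_1[where 'p='a] by (intro power_mono) simp_all
    finally have "int (a + b) < int CARD('a) ^ ?n" by (metis of_nat_less_iff of_nat_power)
    then show "a = b"
      using arg_cong[OF eq, of "\<lambda>x. Rep_padic_int x ?n"] by (simp add: Rep_padic_int_of_nat)
  qed
qed

section \<open>The $p$-adic numbers\<close>

instance fract :: ("{idom, ring_char_0}") ring_char_0
  by standard (auto intro!: injI simp: of_nat_fract eq_fract)

instance fract :: ("{idom, ring_char_0}") field_char_0 ..

type_synonym 'p padic = "'p padic_int fract"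

definition padic_integers :: "'p::prime_card padic set" where
  "padic_integers = range to_fract"

text \<open>
  The $p$-adic valuation of a nonzero $x$ is the unique integer $m$ such that $x = p^m u$
  with $u$ a unit of the ring of $p$-adic integers. Its value at $0$ is irrelevant.
\<close>

definition padic_val :: "'p::prime_card padic \<Rightarrow> int" where
  "padic_val x = (THE m. \<exists>u. u dvd 1 \<and> x = of_nat CARD('p) powi m * to_fract u)"

definition padic_val_pow :: "nat \<Rightarrow> 'p::prime_card padic \<Rightarrow> int" where
  "padic_val_pow l x = \<lfloor>of_int (padic_val x) / (of_nat l :: rat)\<rfloor>"

definition padic_reduced :: "nat \<Rightarrow> 'p::prime_card padic \<Rightarrow> 'p padic" where
  "padic_reduced l x =
    (if x = 0 then 0 else of_nat CARD('p) powi (- (int l * padic_val_pow l x)) * x)"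

definition padic_integer_roots :: "'p::prime_card padic poly \<Rightarrow> 'p padic set" where
  "padic_integer_roots f = {x \<in> padic_integers. poly f x = 0}"

subsection \<open>The valuation is well defined\<close>

lemma to_fract_of_nat: "to_fract (of_nat k) = (of_nat k :: 'p::prime_card padic)"
  by (simp add: to_fract_def of_nat_fract)

lemma to_fract_power: "to_fract (x ^ n) = to_fract (x :: 'p::prime_card padic_int) ^ n"
  by (induction n) simp_all

lemma padic_int_power_dvd:
  fixes x :: "'p::prime_card padic_int"
  assumes "Rep_padic_int x m = 0"
  shows "of_nat CARD('p) ^ m dvd x"
proof -
  let ?q = "int CARD('p)"
  define y where "y n = Rep_padic_int x (n + m) div ?q ^ m" for n
  have dv: "?q ^ m dvd Rep_padic_int x (n + m)" for n
    using Rep_padic_int_mod[of m "n + m" x] assms by (simp add: mod_eq_0_iff_dvd)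
  have "y n \<in> {0..<?q ^ n} \<and> y (Suc n) mod ?q ^ n = y n" for n
  proof
    have "Rep_padic_int x (n + m) < ?q ^ n * ?q ^ m"
      using Rep_padic_int_range(2)[of x "n + m"] by (simp add: power_add)
    moreover have "Rep_padic_int x (n + m) div ?q ^ m * ?q ^ m = Rep_padic_int x (n + m)"
      using dv[of n] by simp
    ultimately have "Rep_padic_int x (n + m) div ?q ^ m < ?q ^ n"
      by (metis int_CARD_power_pos mult_less_cancel_right_pos)
    then show "y n \<in> {0..<?q ^ n}"
      using Rep_padic_int_range(1)[of x "n + m"]
      by (simp add: y_def pos_imp_zdiv_nonneg_iff)
    have "?q ^ m * y n = Rep_padic_int x (Suc n + m) mod (?q ^ m * ?q ^ n)"
      using Rep_padic_int_mod[of "n + m" "Suc n + m" x] dv[of n]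
      by (simp add: y_def power_add mult.commute)
    also have "\<dots> = (?q ^ m * y (Suc n)) mod (?q ^ m * ?q ^ n)"
      using dv[of "Suc n"] by (simp add: y_def)
    also have "\<dots> = ?q ^ m * (y (Suc n) mod ?q ^ n)"
      by (simp only: mult_mod_right)
    finally show "y (Suc n) mod ?q ^ n = y n" by simp
  qed
  then have y: "Rep_padic_int (Abs_padic_int y :: 'p padic_int) = y"
    by (intro Abs_padic_int_inverse) simp
  have "x = of_nat (CARD('p) ^ m) * Abs_padic_int y"
  proof (rule Rep_padic_int_inject[THEN iffD1], rule ext)
    fix n
    have "Rep_padic_int (of_nat (CARD('p) ^ m) * Abs_padic_int y :: 'p padic_int) n
        = (?q ^ m * y n) mod ?q ^ n"
      by (simp add: times_padic_int.rep_eq Rep_padic_int_of_nat y mod_simps del: of_nat_power)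
        (simp add: mod_simps)
    also have "\<dots> = Rep_padic_int x n"
      using dv[of n] Rep_padic_int_mod[of n "n + m" x] by (simp add: y_def)
    finally show "Rep_padic_int x n
        = Rep_padic_int (of_nat (CARD('p) ^ m) * Abs_padic_int y :: 'p padic_int) n" ..
  qed
  then show ?thesis by (metis dvd_triv_left of_nat_power)
qed

lemma padic_int_unit:
  fixes x :: "'p::prime_card padic_int"
  assumes "Rep_padic_int x 1 \<noteq> 0"
  shows "x dvd 1"
proof -
  let ?q = "int CARD('p)"
  have "coprime (Rep_padic_int x n) (?q ^ n)" for n
  proof (cases "n = 0")
    case False
    then have "Rep_padic_int x n mod ?q \<noteq> 0"
      using Rep_padic_int_mod[of 1 n x] assms by simp
    then have "coprime ?q (Rep_padic_int x n)"
      using prime_imp_coprime[OF prime_card_int[where 'a='p]] by (simp add: mod_eq_0_iff_dvd)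
    then show ?thesis by (simp add: coprime_commute)
  qed simp
  then have "\<exists>b. [Rep_padic_int x n * b = 1] (mod ?q ^ n)" for n
    by (rule cong_solve_coprime_int)
  then obtain b where b: "\<And>n. [Rep_padic_int x n * b n = 1] (mod ?q ^ n)" by metis
  define y where "y n = b n mod ?q ^ n" for n
  have "y n \<in> {0..<?q ^ n} \<and> y (Suc n) mod ?q ^ n = y n" for n
  proof
    show "y n \<in> {0..<?q ^ n}" by (simp add: y_def)
    have "[Rep_padic_int x (Suc n) * b (Suc n) = 1] (mod ?q ^ n)"
      using b[of "Suc n"] by (rule cong_dvd_modulus) simp
    moreover have "[Rep_padic_int x (Suc n) = Rep_padic_int x n] (mod ?q ^ n)"
      using Rep_padic_int_mod[of n "Suc n" x] Rep_padic_int_mod[of n n x] by (simp add: cong_def)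
    ultimately have s: "[Rep_padic_int x n * b (Suc n) = 1] (mod ?q ^ n)"
      by (meson cong_scalar_right cong_sym cong_trans)
    have "[b (Suc n) = b (Suc n) * (Rep_padic_int x n * b n)] (mod ?q ^ n)"
      using cong_scalar_left[OF cong_sym[OF b[of n]], of "b (Suc n)"] by simp
    also have "b (Suc n) * (Rep_padic_int x n * b n) = Rep_padic_int x n * b (Suc n) * b n"
      by simp
    also have "[\<dots> = 1 * b n] (mod ?q ^ n)" using s by (rule cong_scalar_right)
    finally have "b (Suc n) mod ?q ^ n = b n mod ?q ^ n" by (simp add: cong_def)
    then show "y (Suc n) mod ?q ^ n = y n" unfolding y_def by (simp only: mod_power_Suc_mod)
  qed
  then have y: "Rep_padic_int (Abs_padic_int y :: 'p padic_int) = y"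
    by (intro Abs_padic_int_inverse) simp
  have "x * Abs_padic_int y = 1"
  proof (rule Rep_padic_int_inject[THEN iffD1], rule ext)
    fix n
    show "Rep_padic_int (x * Abs_padic_int y) n = Rep_padic_int (1 :: 'p padic_int) n"
      using b[of n]
      by (simp add: times_padic_int.rep_eq one_padic_int.rep_eq y y_def cong_def mod_simps)
  qed
  then show ?thesis by (metis dvd_triv_left)
qed

lemma padic_int_prime_not_unit: "\<not> (of_nat CARD('p) :: 'p::prime_card padic_int) dvd 1"
proof
  assume "(of_nat CARD('p) :: 'p padic_int) dvd 1"
  then obtain y :: "'p padic_int" where "1 = of_nat CARD('p) * y" by (elim dvdE)
  from arg_cong[OF this, of "\<lambda>x. Rep_padic_int x 1"]
  have "1 mod int CARD('p) = 0"
    by (simp add: times_padic_int.rep_eq one_padic_int.rep_eq Rep_padic_int_of_nat)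
  then show False using CARD_prime_card_gt_1[where 'p='p] by simp
qed

lemma padic_int_decomp:
  fixes x :: "'p::prime_card padic_int"
  assumes "x \<noteq> 0"
  obtains m u where "u dvd 1" "x = of_nat CARD('p) ^ m * u"
proof -
  let ?q = "int CARD('p)"
  define n where "n = (LEAST n. Rep_padic_int x n \<noteq> 0)"
  have "\<exists>n. Rep_padic_int x n \<noteq> 0"
    using assms by (metis Rep_padic_int_inject ext zero_padic_int.rep_eq)
  then have n: "Rep_padic_int x n \<noteq> 0" unfolding n_def by (rule LeastI_ex)
  have "n \<noteq> 0" using n Rep_padic_int_range[of x 0] by (cases n) auto
  then obtain m where m: "n = Suc m" by (cases n) auto
  have "Rep_padic_int x m = 0" using not_less_Least[of m "\<lambda>n. Rep_padic_int x n \<noteq> 0"] m by (auto simp: n_def)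
  then obtain u where u: "x = of_nat CARD('p) ^ m * u"
    using padic_int_power_dvd by (metis dvdE)
  have "Rep_padic_int u 1 \<noteq> 0"
  proof
    assume "Rep_padic_int u 1 = 0"
    then obtain v where "u = of_nat CARD('p) * v"
      using padic_int_power_dvd[of u 1] by (auto elim: dvdE)
    then have "x = of_nat (CARD('p) ^ n) * v" using u m by (simp add: mult_ac)
    then have "Rep_padic_int x n = 0"
      by (simp add: times_padic_int.rep_eq Rep_padic_int_of_nat del: of_nat_power) simp
    with n show False by simp
  qed
  then show ?thesis using that u padic_int_unit by blast
qed

lemma padic_val_ex1:
  fixes x :: "'p::prime_card padic"
  assumes "x \<noteq> 0"
  shows "\<exists>!m. \<exists>u. u dvd 1 \<and> x = of_nat CARD('p) powi m * to_fract u"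
proof -
  let ?p = "of_nat CARD('p) :: 'p padic"
  have p0: "?p \<noteq> 0" by (metis CARD_prime_card_pos less_irrefl of_nat_0_eq_iff)
  obtain a b where ab: "x = Fract a b" "b \<noteq> 0" "a \<noteq> 0"
    using assms by (metis Fract_cases_nonzero)
  obtain m u where a: "u dvd 1" "a = of_nat CARD('p) ^ m * u"
    by (rule padic_int_decomp[OF ab(3)])
  obtain n v where b: "v dvd 1" "b = of_nat CARD('p) ^ n * v"
    by (rule padic_int_decomp[OF ab(2)])
  obtain w where w: "1 = v * w" using b(1) by (elim dvdE)
  have w1: "w dvd 1" by (metis dvd_triv_right w)
  have tv: "to_fract v * to_fract w = 1" by (metis to_fract_1 to_fract_mult w)
  then have v0: "to_fract v \<noteq> 0" by auto
  have "x = to_fract a / to_fract b" using ab by (simp add: to_fract_def)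
  also have "\<dots> = ?p ^ m * to_fract u / (?p ^ n * to_fract v)"
    by (simp only: a(2) b(2) to_fract_mult to_fract_power to_fract_of_nat)
  also have "\<dots> = ?p powi (int m - int n) * (to_fract u * to_fract w)"
    using p0 v0 tv by (simp add: power_int_diff field_simps)
  finally have ex: "x = ?p powi (int m - int n) * to_fract (u * w)" by simp
  have uw: "u * w dvd 1" using a(1) w1 by simp
  have less: False if "c dvd 1" "d dvd 1" "i < j"
    "x = ?p powi i * to_fract c" "x = ?p powi j * to_fract d" for i j c d
  proof -
    define k where "k = nat (j - i)"
    have j: "j = i + int k" and k: "k > 0" using that(3) by (auto simp: k_def)
    have "?p powi i * to_fract c = ?p powi i * (?p ^ k * to_fract d)"
      using that(4,5) p0 by (simp add: j power_int_add mult.assoc)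
    then have "to_fract c = ?p ^ k * to_fract d" using p0 by simp
    also have "\<dots> = to_fract (of_nat CARD('p) ^ k * d)"
      by (simp only: to_fract_mult to_fract_power to_fract_of_nat)
    finally have "c = of_nat CARD('p) ^ k * d" by (simp only: to_fract_eq_iff)
    then have "of_nat CARD('p) dvd c" using k by (simp add: dvd_power)
    then show False using that(1) padic_int_prime_not_unit dvd_trans by blast
  qed
  show ?thesis
  proof (rule ex1I)
    show "\<exists>u. u dvd 1 \<and> x = ?p powi (int m - int n) * to_fract u" using ex uw by blast
  next
    fix i
    assume "\<exists>u. u dvd 1 \<and> x = ?p powi i * to_fract u"
    then show "i = int m - int n" using ex uw less by (metis linorder_neq_iff)
  qed
qed

lemma padic_val:
  fixes x :: "'p::prime_card padic"
  assumes "x \<noteq> 0"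
  obtains u where "u dvd 1" "x = of_nat CARD('p) powi padic_val x * to_fract u"
  using theI'[OF padic_val_ex1[OF assms]] unfolding padic_val_def by blast

lemma padic_val_pow_eq_div: "padic_val_pow l x = padic_val x div int l"
  unfolding padic_val_pow_def by (metis floor_divide_of_int_eq of_int_of_nat_eq)

lemma padic_reduced_integer:
  fixes x :: "'p::prime_card padic"
  assumes "1 \<le> l"
  shows "padic_reduced l x \<in> padic_integers"
proof (cases "x = 0")
  case True
  then show ?thesis unfolding padic_reduced_def padic_integers_def by (metis rangeI to_fract_0)
next
  case False
  let ?p = "of_nat CARD('p) :: 'p padic"
  have p0: "?p \<noteq> 0" by (metis CARD_prime_card_pos less_irrefl of_nat_0_eq_iff)
  obtain u where u: "x = ?p powi padic_val x * to_fract u" by (rule padic_val[OF False])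
  have "padic_reduced l x = ?p powi (- (int l * padic_val_pow l x)) * x"
    using False by (simp add: padic_reduced_def)
  also have "\<dots> = ?p powi (- (int l * padic_val_pow l x) + padic_val x) * to_fract u"
    by (subst (2) u) (simp only: power_int_add[OF disjI1[OF p0]] mult.assoc)
  also have "- (int l * padic_val_pow l x) + padic_val x = padic_val x mod int l"
    by (simp add: padic_val_pow_eq_div minus_mult_div_eq_mod [symmetric])
  also have "?p powi (padic_val x mod int l) = ?p ^ nat (padic_val x mod int l)"
    using assms by (simp add: power_int_def)
  finally have "padic_reduced l x = to_fract (of_nat CARD('p) ^ nat (padic_val x mod int l) * u)"
    by (simp only: to_fract_mult to_fract_power to_fract_of_nat)
  then show ?thesis unfolding padic_integers_def by blast
qed

section \<open>Abelian groups as modules over the integers\<close>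

definition int_scale :: "int \<Rightarrow> 'a::ab_group_add \<Rightarrow> 'a" where
  "int_scale c x = (\<Sum>_<nat c. x) - (\<Sum>_<nat (- c). x)"

lemma sum_const_add: "(\<Sum>_<m + n :: nat. x) = (\<Sum>_<m. x) + (\<Sum>_<n. x :: 'a::ab_group_add)"
  by (induction n) (simp_all add: add_ac)

lemma int_scale_diff:
  "int_scale (int m - int n) x = (\<Sum>_<m. x) - (\<Sum>_<n. x :: 'a::ab_group_add)"
proof (cases "n \<le> m")
  case True
  then obtain k where "m = n + k" by (metis le_iff_add)
  then show ?thesis by (simp add: int_scale_def sum_const_add)
next
  case False
  then obtain k where "n = m + k" by (metis le_iff_add nat_le_linear)
  then show ?thesis by (simp add: int_scale_def sum_const_add)
qed

lemma int_scale_add_left: "int_scale (a + b) x = int_scale a x + int_scale b x"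
proof -
  obtain m n where a: "a = int m - int n" by (metis int_diff_cases)
  obtain k l where b: "b = int k - int l" by (metis int_diff_cases)
  have "a + b = int (m + k) - int (n + l)" by (simp add: a b)
  then show ?thesis by (simp only: a b int_scale_diff sum_const_add) simp
qed

lemma int_scale_add_right: "int_scale a (x + y) = int_scale a x + int_scale a y"
  by (simp add: int_scale_def sum.distrib)

lemma int_scale_0 [simp]: "int_scale 0 x = 0"
  by (simp add: int_scale_def)

lemma int_scale_1 [simp]: "int_scale 1 x = x"
  by (simp add: int_scale_def)

lemma int_scale_minus_left: "int_scale (- a) x = - int_scale a x"
  by (simp add: int_scale_def)

lemma int_scale_scale: "int_scale a (int_scale b x) = int_scale (a * b) x"
proof -
  have nat: "int_scale (int n) (int_scale b x) = int_scale (int n * b) x" for n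
  proof (induction n)
    case (Suc n)
    then show ?case by (simp add: int_scale_add_left distrib_right)
  qed simp
  show ?thesis
  proof (cases a)
    case (nonneg n)
    then show ?thesis using nat by simp
  next
    case (neg n)
    then show ?thesis using nat[of "Suc n"]
      by (simp add: int_scale_minus_left del: of_nat_Suc)
  qed
qed

interpretation int_module: Modules.module "int_scale :: int \<Rightarrow> 'a \<Rightarrow> 'a::ab_group_add"
  by unfold_locales
    (simp_all add: int_scale_add_left int_scale_add_right int_scale_scale)

lemma int_scale_fun: "int_scale c f n = int_scale c (f n :: 'a::ab_group_add)"
proof -
  have "(\<Sum>_<k. f) n = (\<Sum>_<k. f n)" for k :: nat
    by (induction k) simp_all
  then show ?thesis by (simp add: int_scale_def)
qed

lemma int_scale_of_int: "int_scale c x = of_int c * (x :: 'a::ring_1)"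
proof (cases c)
  case (nonneg n)
  then show ?thesis by (simp add: int_scale_def)
next
  case (neg n)
  then show ?thesis by (simp add: int_scale_def algebra_simps)
qed

section \<open>Regular sequences\<close>

definition k_kernel :: "nat \<Rightarrow> (nat \<Rightarrow> 'a) \<Rightarrow> (nat \<Rightarrow> 'a) set" where
  "k_kernel k a = {(\<lambda>n. a (k ^ i * n + j)) | i j. j < k ^ i}"

text \<open>
  Sequences form an abelian group under pointwise addition, so \<open>int_module.span\<close> of a set of
  sequences is the submodule that it generates over the integers. For a sequence with values in a
  subgroup of \<open>'a\<close>, the submodule generated by the kernel consists of sequences with values in
  that subgroup, so it does not matter whether regularity is considered in the subgroup
  or in \<open>'a\<close>.
\<close>

definition k_regular :: "nat \<Rightarrow> (nat \<Rightarrow> 'a::ab_group_add) \<Rightarrow> bool" where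
  "k_regular k a \<longleftrightarrow> 2 \<le> k \<and>
    (\<exists>S. finite S \<and> int_module.span S = int_module.span (k_kernel k a))"

definition regular :: "(nat \<Rightarrow> 'a::ab_group_add) \<Rightarrow> bool" where
  "regular a \<longleftrightarrow> (\<exists>k\<ge>2. k_regular k a)"

definition mult_indep :: "nat \<Rightarrow> nat \<Rightarrow> bool" where
  "mult_indep k m \<longleftrightarrow> (\<forall>a\<ge>1. \<forall>c\<ge>1. k ^ a \<noteq> m ^ c)"

definition strictly_k_regular :: "nat \<Rightarrow> (nat \<Rightarrow> 'a::ab_group_add) \<Rightarrow> bool" where
  "strictly_k_regular k a \<longleftrightarrow>
    k_regular k a \<and> (\<forall>m\<ge>2. mult_indep k m \<longrightarrow> \<not> k_regular m a)"

end

theory Submission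
  imports Defs
begin

text \<open>
  Positive part: by compactness of \<open>\<int>\<^sub>p\<close> it suffices that the sequence agrees with a
  \<open>k\<close>-regular sequence on a ball around each point. Around a point that is not a root the
  valuation of \<open>f\<close> is constant, and the sequence is polynomial. Around a rational root \<open>a / b\<close> it is a
  polynomial times the reduction of \<open>p\<^sup>c (b n - a)\<^sup>e\<close>, and replacing \<open>n\<close> by \<open>p n + j\<close> turns
  \<open>b n - a\<close> into either a unit or \<open>p (b n - a')\<close>, with only finitely many \<open>a'\<close> occurring.

  Negative part: the module generated by the kernel of a \<open>k\<close>-regular sequence is
  spanned by finitely many kernel elements, so all kernel elements are continuous on \<open>\<int>\<^sub>p\<close>
  outside one finite set. But the element with index \<open>(i, j)\<close> is discontinuous at every root of
  \<open>f (k\<^sup>i X + j)\<close>. These roots form an infinite set if \<open>f\<close> has an irrational root in \<open>\<int>\<^sub>p\<close>, or if it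
  has a root in \<open>\<int>\<^sub>p\<close> and \<open>k\<close> is not a power of \<open>p\<close>.
\<close>

section \<open>Valuations\<close>

abbreviation padic_p :: "'p::prime_card padic" where
  "padic_p \<equiv> of_nat CARD('p)"

lemma padic_p_nonzero [simp]: "(padic_p :: 'p::prime_card padic) \<noteq> 0"
  by (metis CARD_prime_card_pos less_irrefl of_nat_0_eq_iff)

lemma padic_val_unique:
  assumes "u dvd 1"
  shows "padic_val (padic_p powi m * to_fract u :: 'p::prime_card padic) = m"
proof -
  have "u \<noteq> 0" using assms by auto
  then have "padic_p powi m * to_fract u \<noteq> (0 :: 'p padic)" by simp
  from padic_val_ex1[OF this] show ?thesis
    unfolding padic_val_def by (rule the1_equality) (use assms in blast)
qed

lemma padic_val_p_powi [simp]: "padic_val (padic_p powi m :: 'p::prime_card padic) = m"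
  using padic_val_unique[of 1 m] by simp

lemma padic_val_p_power [simp]: "padic_val (padic_p ^ n :: 'p::prime_card padic) = int n"
  using padic_val_p_powi[of "int n"] by simp

lemma padic_val_mult:
  fixes x y :: "'p::prime_card padic"
  assumes "x \<noteq> 0" "y \<noteq> 0"
  shows "padic_val (x * y) = padic_val x + padic_val y"
proof -
  obtain u where u: "u dvd 1" "x = padic_p powi padic_val x * to_fract u"
    by (rule padic_val[OF assms(1)])
  obtain v where v: "v dvd 1" "y = padic_p powi padic_val y * to_fract v"
    by (rule padic_val[OF assms(2)])
  have "x * y = padic_p powi (padic_val x + padic_val y) * to_fract (u * v)"
    by (subst u(2), subst v(2)) (simp add: power_int_add mult_ac)
  then show ?thesis using padic_val_unique[of "u * v"] u(1) v(1) by simp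
qed

lemma padic_val_1 [simp]: "padic_val (1 :: 'p::prime_card padic) = 0"
  using padic_val_p_power[of 0] by simp

lemma padic_val_power:
  fixes x :: "'p::prime_card padic"
  assumes "x \<noteq> 0"
  shows "padic_val (x ^ n) = int n * padic_val x"
  by (induction n) (simp_all add: padic_val_mult assms algebra_simps)

definition padic_ge :: "int \<Rightarrow> 'p::prime_card padic \<Rightarrow> bool" where
  "padic_ge m x \<longleftrightarrow> x = 0 \<or> m \<le> padic_val x"

text \<open>Written as multiples of \<open>p^m\<close>, these elements visibly form a group, so the
  ultrametric inequality comes from addition in the ring of p-adic integers.\<close>

lemma padic_ge_iff:
  "padic_ge m x \<longleftrightarrow> (\<exists>z. x = padic_p powi m * to_fract (z :: 'p::prime_card padic_int))"
proof
  assume ge: "padic_ge m x"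
  show "\<exists>z. x = padic_p powi m * to_fract z"
  proof (cases "x = 0")
    case True
    then show ?thesis by (intro exI[of _ 0]) simp
  next
    case False
    obtain u where u: "x = padic_p powi padic_val x * to_fract u"
      by (rule padic_val[OF False])
    define k where "k = nat (padic_val x - m)"
    have k: "padic_val x = m + int k" using ge False by (simp add: k_def padic_ge_def)
    have "x = padic_p powi m * to_fract (of_nat CARD('p) ^ k * u)"
      by (subst u) (simp add: k power_int_add to_fract_power to_fract_of_nat)
    then show ?thesis by blast
  qed
next
  assume "\<exists>z. x = padic_p powi m * to_fract z"
  then obtain z where z: "x = padic_p powi m * to_fract z" by blast
  show "padic_ge m x"
  proof (cases "z = 0")
    case False
    then obtain k u where u: "u dvd 1" "z = of_nat CARD('p) ^ k * u"
      by (rule padic_int_decomp)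
    have "x = padic_p powi (m + int k) * to_fract u"
      by (simp add: z u(2) power_int_add to_fract_power to_fract_of_nat)
    then have "padic_val x = m + int k" using padic_val_unique[OF u(1)] by simp
    then show ?thesis by (simp add: padic_ge_def)
  qed (simp add: z padic_ge_def)
qed

lemma padic_ge_0 [simp]: "padic_ge m 0"
  by (simp add: padic_ge_def)

lemma padic_ge_mono: "padic_ge m x \<Longrightarrow> n \<le> m \<Longrightarrow> padic_ge n x"
  by (auto simp: padic_ge_def)

lemma padic_ge_add: "padic_ge m x \<Longrightarrow> padic_ge m y \<Longrightarrow> padic_ge m (x + y)"
  unfolding padic_ge_iff by (metis distrib_left to_fract_add)

lemma padic_ge_mult: "padic_ge m x \<Longrightarrow> padic_ge n y \<Longrightarrow> padic_ge (m + n) (x * y)"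
  by (cases "x = 0"; cases "y = 0") (simp_all add: padic_ge_def padic_val_mult)

lemma padic_ge_cancel:
  assumes "z \<noteq> 0" "padic_ge m (z * x)"
  shows "padic_ge (m - padic_val z) x"
  using assms by (cases "x = 0") (simp_all add: padic_ge_def padic_val_mult)

lemma padic_integers_iff: "x \<in> padic_integers \<longleftrightarrow> padic_ge 0 x"
  by (auto simp: padic_ge_iff padic_integers_def)

lemma padic_ge_0_of_nat [simp]: "padic_ge 0 (of_nat n)"
  unfolding padic_integers_iff[symmetric] padic_integers_def by (metis rangeI to_fract_of_nat)

lemma padic_ge_uminus [simp]: "padic_ge m (- x) \<longleftrightarrow> padic_ge m x"
proof -
  have "padic_ge m (- x)" if "padic_ge m x" for x :: "'a padic"
    using that unfolding padic_ge_iff by (metis mult_minus_right to_fract_uminus)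
  from this[of x] this[of "- x"] show ?thesis by auto
qed

lemma padic_ge_diff: "padic_ge m x \<Longrightarrow> padic_ge m y \<Longrightarrow> padic_ge m (x - y)"
  using padic_ge_add[of m x "- y"] by simp

lemma padic_ge_0_of_int [simp]: "padic_ge 0 (of_int n)"
  by (cases n) (simp_all add: padic_ge_diff del: of_nat_Suc)

lemma padic_ge_mult_0: "padic_ge 0 x \<Longrightarrow> padic_ge m y \<Longrightarrow> padic_ge m (x * y)"
  using padic_ge_mult[of 0 x m y] by simp

lemma padic_ge_0_power: "padic_ge 0 x \<Longrightarrow> padic_ge 0 (x ^ n)"
  by (induction n) (simp_all add: padic_ge_mult_0 padic_ge_def[of 0 1])

lemma padic_ge_diff_commute: "padic_ge m (x - y) \<Longrightarrow> padic_ge m (y - x)"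
  by (metis minus_diff_eq padic_ge_uminus)

lemma padic_ge_diff_trans: "padic_ge m (x - y) \<Longrightarrow> padic_ge m (y - z) \<Longrightarrow> padic_ge m (x - z)"
  using padic_ge_add[of m "x - y" "y - z"] by simp

lemma padic_ge_p_powi [simp]: "padic_ge m (padic_p powi n :: 'p::prime_card padic) \<longleftrightarrow> m \<le> n"
  by (simp add: padic_ge_def)

lemma padic_ge_p_power [simp]: "padic_ge m (padic_p ^ n :: 'p::prime_card padic) \<longleftrightarrow> m \<le> int n"
  by (simp add: padic_ge_def)

text \<open>The strict ultrametric inequality: if \<open>y\<close> had larger valuation than
  \<open>x\<close>, then so would \<open>x = y - (y - x)\<close>.\<close>

lemma padic_val_perturb:
  fixes x y :: "'p::prime_card padic"
  assumes "x \<noteq> 0" "padic_ge m (y - x)" "padic_val x < m"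
  shows "y \<noteq> 0" "padic_val y = padic_val x"
proof -
  show y: "y \<noteq> 0"
    using assms padic_ge_uminus[of m x] by (auto simp: padic_ge_def)
  have "padic_ge (padic_val x) y"
    using padic_ge_add[of "padic_val x" "y - x" x] assms padic_ge_mono[of m "y - x"]
    by (simp add: padic_ge_def)
  moreover have "\<not> padic_ge (padic_val x + 1) y"
  proof
    assume "padic_ge (padic_val x + 1) y"
    then have "padic_ge (padic_val x + 1) (y - (y - x))"
      by (rule padic_ge_diff) (rule padic_ge_mono[OF assms(2)], use assms(3) in simp)
    then show False using assms(1) by (simp add: padic_ge_def)
  qed
  ultimately show "padic_val y = padic_val x" using y by (simp add: padic_ge_def)
qed

section \<open>Residues, and approximation of p-adic integers by natural numbers\<close>

lemma padic_ge_of_int_iff: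
  "padic_ge (int N) (of_int i :: 'p::prime_card padic) \<longleftrightarrow> int CARD('p) ^ N dvd i"
proof
  assume "padic_ge (int N) (of_int i :: 'p padic)"
  then obtain z where "of_int i = (padic_p :: 'p padic) powi int N * to_fract z"
    by (auto simp: padic_ge_iff)
  then have "to_fract (of_int i) = to_fract (of_nat CARD('p) ^ N * z)"
    by (cases i) (simp_all add: to_fract_power to_fract_of_nat)
  then have "of_int i = of_nat (CARD('p) ^ N) * z" by (simp only: to_fract_eq_iff of_nat_power)
  \<comment> \<open>Residues are computed by \<open>Rep_padic_int_of_nat\<close> for natural
    numbers, so a possibly negative \<open>i\<close> is first reduced modulo
    \<open>p^N\<close>.\<close>
  moreover define j where "j = nat (i mod int CARD('p) ^ N)"
  have "i = int CARD('p) ^ N * (i div int CARD('p) ^ N) + int j"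
    by (simp add: j_def)
  ultimately have "of_nat j = (of_nat (CARD('p) ^ N) :: 'p padic_int) * (z - of_int (i div int CARD('p) ^ N))"
    by (metis (no_types, opaque_lifting) add_diff_cancel_left' of_int_add of_int_mult of_int_of_nat_eq of_nat_power right_diff_distrib)
  from arg_cong[OF this, of "\<lambda>x. Rep_padic_int x N"]
  have "int j mod int CARD('p) ^ N = 0"
    by (simp add: times_padic_int.rep_eq Rep_padic_int_of_nat del: of_nat_power) simp
  then show "int CARD('p) ^ N dvd i" by (simp add: j_def mod_eq_0_iff_dvd)
next
  assume "int CARD('p) ^ N dvd i"
  then obtain k where "i = int CARD('p) ^ N * k" by (elim dvdE)
  then have "of_int i = (padic_p :: 'p padic) ^ N * of_int k" by simp
  then show "padic_ge (int N) (of_int i :: 'p padic)"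
    using padic_ge_mult[of "int N" "padic_p ^ N" 0 "of_int k :: 'p padic"] by simp
qed

lemma padic_ge_of_nat_diff_iff:
  "padic_ge (int N) (of_nat a - of_nat b :: 'p::prime_card padic)
    \<longleftrightarrow> a mod CARD('p) ^ N = b mod CARD('p) ^ N"
proof -
  have "(of_nat a - of_nat b :: 'p padic) = of_int (int a - int b)" by simp
  then show ?thesis
    by (metis mod_eq_dvd_iff of_nat_eq_iff of_nat_power padic_ge_of_int_iff zmod_int)
qed

lemma Rep_padic_int_diff:
  "Rep_padic_int (x - y :: 'p::prime_card padic_int) n
    = (Rep_padic_int x n - Rep_padic_int y n) mod int CARD('p) ^ n"
  unfolding minus_padic_int_def plus_padic_int.rep_eq uminus_padic_int.rep_eq
  by (simp add: mod_add_right_eq)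

lemma padic_ge_Rep:
  "padic_ge (int N) (to_fract x - of_nat (nat (Rep_padic_int x N)) :: 'p::prime_card padic)"
proof -
  have "Rep_padic_int (x - of_nat (nat (Rep_padic_int x N))) N = 0"
    unfolding Rep_padic_int_diff Rep_padic_int_of_nat using Rep_padic_int_range[of x N] by simp
  then have "of_nat CARD('p) ^ N dvd x - of_nat (nat (Rep_padic_int x N))"
    by (rule padic_int_power_dvd)
  then obtain z where "x - of_nat (nat (Rep_padic_int x N)) = of_nat CARD('p) ^ N * z"
    by (elim dvdE)
  then have "to_fract x - of_nat (nat (Rep_padic_int x N)) = (padic_p :: 'p padic) powi int N * to_fract z"
    by (metis power_int_of_nat to_fract_diff to_fract_mult to_fract_of_nat to_fract_power)
  then show ?thesis unfolding padic_ge_iff by blast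
qed

text \<open>Density of the natural numbers in the p-adic integers, by truncating the expansion. The
  bound on \<open>n\<close> later makes it an admissible kernel index.\<close>

lemma padic_integer_approx:
  fixes x :: "'p::prime_card padic"
  assumes "padic_ge 0 x"
  obtains n where "n < CARD('p) ^ N" "padic_ge (int N) (of_nat n - x)"
proof -
  obtain z where z: "x = to_fract z" using assms by (auto simp: padic_ge_iff)
  have "nat (Rep_padic_int z N) < CARD('p) ^ N"
    using Rep_padic_int_range[of z N] by (simp add: nat_less_iff)
  then show ?thesis
    using that z padic_ge_diff_commute[OF padic_ge_Rep] by blast
qed

section \<open>Finitely generated submodules\<close>

text \<open>A nonzero subgroup of the integers is generated by its least positive element, by
  division with remainder.\<close>

lemma int_ideal_principal:
  fixes I :: "int set"
  assumes "0 \<in> I" "\<And>a b. a \<in> I \<Longrightarrow> b \<in> I \<Longrightarrow> a - b \<in> I"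
  shows "\<exists>d\<in>I. \<forall>a\<in>I. d dvd a"
proof (cases "I = {0}")
  case False
  have neg: "- a \<in> I" if "a \<in> I" for a using assms(2)[OF assms(1) that] by simp
  have add: "a + b \<in> I" if "a \<in> I" "b \<in> I" for a b
    using assms(2)[OF that(1) neg[OF that(2)]] by simp
  obtain a where a: "a \<in> I" "a \<noteq> 0" using False assms(1) by auto
  define n where "n = (LEAST n. n > 0 \<and> int n \<in> I)"
  have "int (nat \<bar>a\<bar>) \<in> I" using a(1) neg[OF a(1)] by (simp add: abs_if)
  then have "\<exists>n>0. int n \<in> I" using a(2) by (intro exI[of _ "nat \<bar>a\<bar>"]) simp
  then have n: "n > 0" "int n \<in> I"
    using LeastI_ex[of "\<lambda>n. n > 0 \<and> int n \<in> I"] by (auto simp: n_def)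
  have mult: "int n * int k \<in> I" for k
    by (induction k) (simp_all add: assms(1) distrib_left add n(2))
  have multi: "int n * k \<in> I" for k
    using mult[of "nat k"] neg[OF mult[of "nat (- k)"]] by (cases "k \<ge> 0") simp_all
  have "int n dvd b" if "b \<in> I" for b
  proof -
    have "b mod int n \<in> I"
      using assms(2)[OF that multi[of "b div int n"]] by (simp add: minus_mult_div_eq_mod)
    moreover have "nat (b mod int n) < n" using n(1) by (simp add: nat_less_iff)
    ultimately have "\<not> b mod int n > 0"
      using not_less_Least[of "nat (b mod int n)" "\<lambda>n. n > 0 \<and> int n \<in> I"] by (auto simp: n_def)
    then show ?thesis using n(1) by (metis dvd_eq_mod_eq_0 of_nat_0_less_iff order_le_less pos_mod_sign)
  qed
  then show ?thesis using n(2) by blast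
qed simp

text \<open>The integers are Noetherian. The induction adds one generator \<open>x\<close>: the
  coefficients of \<open>x\<close> occurring in \<open>V\<close> form an ideal, and an element of
  \<open>V\<close> realizing its generator is added to generators of the intersection of
  \<open>V\<close> with the span of \<open>T\<close>.\<close>

lemma int_submodule_finitely_generated:
  assumes "finite T" "int_module.subspace V" "V \<subseteq> int_module.span T"
  shows "\<exists>S. finite S \<and> int_module.span S = (V :: 'a::ab_group_add set)"
  using assms
proof (induction T arbitrary: V rule: finite_induct)
  case empty
  then have "V = {0}" using int_module.subspace_0 by auto
  then show ?case by (intro exI[of _ "{}"]) simp
next
  case (insert x T)
  note V = \<open>int_module.subspace V\<close>
  define I where "I = {c. \<exists>t \<in> int_module.span T. int_scale c x + t \<in> V}"
  have "\<exists>d\<in>I. \<forall>a\<in>I. d dvd a"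
  proof (rule int_ideal_principal)
    show "0 \<in> I"
      using int_module.subspace_0[OF V] int_module.span_zero by (auto simp: I_def intro!: bexI[of _ 0])
    fix a b assume "a \<in> I" "b \<in> I"
    then obtain t u where tu: "t \<in> int_module.span T" "u \<in> int_module.span T"
      "int_scale a x + t \<in> V" "int_scale b x + u \<in> V" by (auto simp: I_def)
    have "int_scale (a - b) x + (t - u) = (int_scale a x + t) - (int_scale b x + u)"
      by (simp add: int_module.scale_left_diff_distrib)
    then have "int_scale (a - b) x + (t - u) \<in> V"
      using int_module.subspace_diff[OF V tu(3,4)] by metis
    then show "a - b \<in> I" using int_module.span_diff[OF tu(1,2)] by (auto simp: I_def)
  qed
  then obtain d where d: "d \<in> I" "\<And>a. a \<in> I \<Longrightarrow> d dvd a" by blast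
  then obtain t where t: "t \<in> int_module.span T" "int_scale d x + t \<in> V" by (auto simp: I_def)
  have "int_module.subspace (V \<inter> int_module.span T)"
    by (intro int_module.subspace_inter V int_module.subspace_span)
  from insert.IH[OF this] obtain S where S: "finite S"
    "int_module.span S = V \<inter> int_module.span T" by auto
  let ?w = "int_scale d x + t"
  have "int_module.span (insert ?w S) = V"
  proof
    have "S \<subseteq> V" using S(2) int_module.span_superset by blast
    then show "int_module.span (insert ?w S) \<subseteq> V"
      using t(2) by (intro int_module.span_minimal V) auto
    show "V \<subseteq> int_module.span (insert ?w S)"
    proof
      fix v assume v: "v \<in> V"
      then have "v \<in> int_module.span (insert x T)" using insert.prems by auto
      then obtain c where c: "v - int_scale c x \<in> int_module.span T"
        by (auto simp: int_module.span_insert)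
      then have "c \<in> I" using v by (auto simp: I_def intro!: bexI[of _ "v - int_scale c x"])
      then obtain e where e: "c = e * d" using d(2) by (metis dvdE mult.commute)
      \<comment> \<open>Subtracting this multiple of \<open>?w\<close> cancels the multiple of
        \<open>x\<close>, so the remainder lies in the part covered by the induction
        hypothesis.\<close>
      define u where "u = v - int_scale e ?w"
      have "u \<in> V" unfolding u_def
        by (intro int_module.subspace_diff V v int_module.subspace_scale t(2))
      moreover have "u = (v - int_scale c x) - int_scale e t"
        by (simp add: u_def e int_scale_add_right int_scale_scale)
      then have "u \<in> int_module.span T"
        using int_module.span_diff[OF c int_module.span_scale[OF t(1)]] by simp
      ultimately have "u \<in> int_module.span S" using S(2) by blast
      then show "v \<in> int_module.span (insert ?w S)"
        unfolding int_module.span_insert u_def by blast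
    qed
  qed
  then show ?case using S(1) by blast
qed

section \<open>Closure properties of regular sequences\<close>

definition decimate :: "nat \<Rightarrow> nat \<Rightarrow> (nat \<Rightarrow> 'a) \<Rightarrow> nat \<Rightarrow> 'a" where
  "decimate k j a n = a (k * n + j)"

lemma decimate_add: "decimate k j (a + b) = decimate k j a + decimate k j b"
  by (simp add: decimate_def fun_eq_iff)

lemma decimate_scale: "decimate k j (int_scale c a) = int_scale c (decimate k j a)"
  by (simp add: decimate_def fun_eq_iff int_scale_fun)

lemma decimate_0: "decimate k j 0 = 0"
  by (simp add: decimate_def fun_eq_iff)

lemma decimate_span:
  assumes "\<And>t. t \<in> T \<Longrightarrow> decimate k j t \<in> int_module.span U" "a \<in> int_module.span T"
  shows "decimate k j a \<in> int_module.span U"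
  using assms(2)
proof (induction rule: int_module.span_induct_alt)
  case base
  show ?case unfolding decimate_0 by (rule int_module.span_zero)
next
  case (step c x y)
  show ?case unfolding decimate_add decimate_scale
    by (rule int_module.span_add[OF int_module.span_scale[OF assms(1)[OF step(1)]] step(2)])
qed

text \<open>For finite \<open>T\<close> this is a linear representation: every one-step decimation
  is an integer combination of the family. Single steps control the whole kernel, because a
  decimation by \<open>k^i\<close> is a chain of \<open>i\<close> steps, one per
  base-\<open>k\<close> digit.\<close>

definition decimation_closed :: "nat \<Rightarrow> (nat \<Rightarrow> 'a::ab_group_add) set \<Rightarrow> bool" where
  "decimation_closed k T \<longleftrightarrow> (\<forall>t\<in>T. \<forall>j<k. decimate k j t \<in> int_module.span T)"

lemma k_kernel_iff: "b \<in> k_kernel k a \<longleftrightarrow> (\<exists>i j. j < k ^ i \<and> b = decimate (k ^ i) j a)"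
  by (auto simp: k_kernel_def decimate_def fun_eq_iff)

lemma k_kernel_refl: "a \<in> k_kernel k a"
  unfolding k_kernel_iff by (intro exI[of _ 0]) (simp add: decimate_def fun_eq_iff)

lemma k_kernel_span_decimate:
  assumes "decimation_closed k T" "a \<in> int_module.span T" "j < k ^ i"
  shows "decimate (k ^ i) j a \<in> int_module.span T"
  using assms(3)
proof (induction i arbitrary: j)
  case 0
  then show ?case using assms(2) by (simp add: decimate_def[abs_def])
next
  case (Suc i)
  then have k: "k > 0" by (cases k) auto
  \<comment> \<open>Here \<open>q\<close> is the leading base-\<open>k\<close> digit of
    \<open>j\<close>; its decimation is applied after that of the \<open>i\<close> lower
    digits.\<close>
  define q r where "q = j div k ^ i" and "r = j mod k ^ i"
  have j: "j = k ^ i * q + r" by (simp add: q_def r_def)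
  have "k ^ Suc i * n + j = k ^ i * (k * n + q) + r" for n
    unfolding j by (simp add: distrib_left mult_ac)
  then have eq: "decimate (k ^ Suc i) j a = decimate k q (decimate (k ^ i) r a)"
    by (simp add: decimate_def fun_eq_iff)
  have "q < k" "r < k ^ i" unfolding q_def r_def using Suc.prems k by (simp_all add: less_mult_imp_div_less)
  show ?case unfolding eq
  proof (rule decimate_span)
    show "decimate k q t \<in> int_module.span T" if "t \<in> T" for t
      using assms(1) that \<open>q < k\<close> unfolding decimation_closed_def by blast
    show "decimate (k ^ i) r a \<in> int_module.span T" by (rule Suc.IH[OF \<open>r < k ^ i\<close>])
  qed
qed

text \<open>The family may span more than the kernel does: the module of the kernel is a submodule
  of the span of \<open>T\<close>, hence still finitely generated.\<close>

lemma k_regularI: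
  assumes "2 \<le> k" "finite T" "decimation_closed k T" "a \<in> int_module.span T"
  shows "k_regular k a"
proof -
  have "k_kernel k a \<subseteq> int_module.span T"
    using k_kernel_span_decimate[OF assms(3,4)] by (auto simp: k_kernel_iff)
  then have "int_module.span (k_kernel k a) \<subseteq> int_module.span T"
    by (intro int_module.span_minimal int_module.subspace_span)
  from int_submodule_finitely_generated[OF assms(2) int_module.subspace_span this]
  show ?thesis using assms(1) by (simp add: k_regular_def)
qed

lemma k_regularE:
  assumes "k_regular k a"
  obtains T where "finite T" "decimation_closed k T" "a \<in> int_module.span T"
proof -
  from assms obtain T where T: "finite T" "int_module.span T = int_module.span (k_kernel k a)"
    by (auto simp: k_regular_def)
  have "decimate k j t \<in> int_module.span (k_kernel k a)" if "t \<in> k_kernel k a" "j < k" for t j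
  proof -
    obtain i m where t: "m < k ^ i" "t = decimate (k ^ i) m a" using \<open>t \<in> _\<close> by (auto simp: k_kernel_iff)
    have "decimate k j t = decimate (k ^ Suc i) (k ^ i * j + m) a"
      by (simp add: t(2) decimate_def fun_eq_iff algebra_simps)
    moreover have "k ^ i * j + m < k ^ i * Suc j" using t(1) by simp
    then have "k ^ i * j + m < k ^ Suc i"
      using mult_le_mono2[of "Suc j" k "k ^ i"] \<open>j < k\<close> by (simp add: mult.commute)
    ultimately have "decimate k j t \<in> k_kernel k a" unfolding k_kernel_iff by blast
    then show ?thesis by (rule int_module.span_base)
  qed
  then have "decimation_closed k T"
    unfolding decimation_closed_def T(2)
    using decimate_span int_module.span_base T(2) by metis
  moreover have "a \<in> int_module.span T"
    unfolding T(2) by (intro int_module.span_base k_kernel_refl)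
  ultimately show ?thesis using that T(1) by blast
qed

lemma k_regular_add:
  assumes "k_regular k a" "k_regular k b"
  shows "k_regular k (a + b)"
proof -
  obtain T where T: "finite T" "decimation_closed k T" "a \<in> int_module.span T"
    by (rule k_regularE[OF assms(1)])
  obtain U where U: "finite U" "decimation_closed k U" "b \<in> int_module.span U"
    by (rule k_regularE[OF assms(2)])
  have sub: "int_module.span T \<subseteq> int_module.span (T \<union> U)" "int_module.span U \<subseteq> int_module.span (T \<union> U)"
    by (intro int_module.span_mono; simp)+
  show ?thesis
  proof (rule k_regularI[of k "T \<union> U"])
    show "2 \<le> k" using assms(1) by (simp add: k_regular_def)
    show "decimation_closed k (T \<union> U)"
      using T(2) U(2) sub unfolding decimation_closed_def by blast
    show "a + b \<in> int_module.span (T \<union> U)"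
      using T(3) U(3) sub by (intro int_module.span_add) auto
  qed (simp add: T(1) U(1))
qed

lemma int_scale_mult_left: "int_scale c x * y = int_scale c (x * y :: 'a::comm_ring_1)"
  by (simp add: int_scale_of_int mult.assoc)

lemma span_times:
  fixes T U :: "(nat \<Rightarrow> 'a::comm_ring_1) set"
  assumes "a \<in> int_module.span T" "b \<in> int_module.span U"
  shows "a * b \<in> int_module.span ((\<lambda>(t, u). t * u) ` (T \<times> U))"
proof -
  have one: "t * b \<in> int_module.span ((\<lambda>(t, u). t * u) ` (T \<times> U))" if "t \<in> T" for t
    using assms(2)
  proof (induction rule: int_module.span_induct_alt)
    case base
    show ?case unfolding mult_zero_right by (rule int_module.span_zero)
  next
    case (step c x y)
    have "t * (int_scale c x + y) = int_scale c (t * x) + t * y"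
      by (metis distrib_left int_scale_mult_left mult.commute)
    moreover have "t * x \<in> int_module.span ((\<lambda>(t, u). t * u) ` (T \<times> U))"
      using step.hyps that by (intro int_module.span_base) blast
    ultimately show ?case
      using step.IH by (metis int_module.span_add int_module.span_scale)
  qed
  show ?thesis using assms(1)
  proof (induction rule: int_module.span_induct_alt)
    case base
    show ?case unfolding mult_zero_left by (rule int_module.span_zero)
  next
    case (step c x y)
    show ?case unfolding distrib_right int_scale_mult_left
      by (rule int_module.span_add[OF int_module.span_scale[OF one[OF step(1)]] step(2)])
  qed
qed

lemma k_regular_times:
  fixes a b :: "nat \<Rightarrow> 'a::comm_ring_1"
  assumes "k_regular k a" "k_regular k b"
  shows "k_regular k (a * b)"
proof -
  obtain T where T: "finite T" "decimation_closed k T" "a \<in> int_module.span T"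
    by (rule k_regularE[OF assms(1)])
  obtain U where U: "finite U" "decimation_closed k U" "b \<in> int_module.span U"
    by (rule k_regularE[OF assms(2)])
  have dec: "decimate k j (t * u) = decimate k j t * decimate k j u" for j and t u :: "nat \<Rightarrow> 'a"
    by (simp add: decimate_def fun_eq_iff)
  show ?thesis
  proof (rule k_regularI[of k "(\<lambda>(t, u). t * u) ` (T \<times> U)"])
    show "2 \<le> k" using assms(1) by (simp add: k_regular_def)
    show "decimation_closed k ((\<lambda>(t, u). t * u) ` (T \<times> U))"
      using T(2) U(2) by (auto simp: decimation_closed_def dec intro!: span_times)
  qed (simp_all add: T U span_times)
qed

text \<open>A recursion criterion: a decimation either returns to the finite family or is already
  known to be regular. Adjoining closed families for the decimations of the second kind gives a
  closed family.\<close>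

lemma k_regular_finite_family:
  fixes t :: "'i \<Rightarrow> nat \<Rightarrow> 'a::ab_group_add"
  assumes "2 \<le> k" "finite I" "i \<in> I"
    and "\<And>i j. i \<in> I \<Longrightarrow> j < k \<Longrightarrow> (\<exists>i'\<in>I. decimate k j (t i) = t i') \<or> k_regular k (decimate k j (t i))"
  shows "k_regular k (t i)"
proof -
  \<comment> \<open>The empty family is the default when \<open>b\<close> is not regular, so that
    \<open>U\<close> is total.\<close>
  have "\<exists>U. finite U \<and> decimation_closed k U \<and> (k_regular k b \<longrightarrow> b \<in> int_module.span U)" for b :: "nat \<Rightarrow> 'a"
  proof (cases "k_regular k b")
    case True
    then show ?thesis by (metis k_regularE)
  next
    case False
    then show ?thesis by (intro exI[of _ "{}"]) (simp add: decimation_closed_def)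
  qed
  then obtain U where U: "\<And>b. finite (U b)" "\<And>b. decimation_closed k (U b)"
    "\<And>b :: nat \<Rightarrow> 'a. k_regular k b \<Longrightarrow> b \<in> int_module.span (U b)" by metis
  define T where "T = t ` I \<union> (\<Union>i\<in>I. \<Union>j<k. U (decimate k j (t i)))"
  have sub: "int_module.span (U (decimate k j (t i))) \<subseteq> int_module.span T" if "i \<in> I" "j < k" for i j
    by (rule int_module.span_mono) (use that in \<open>auto simp: T_def\<close>)
  show ?thesis
  proof (rule k_regularI[of k T])
    show "finite T" using assms(2) U(1) by (simp add: T_def)
    show "t i \<in> int_module.span T" using assms(3) by (intro int_module.span_base) (simp add: T_def)
    show "decimation_closed k T"
      unfolding decimation_closed_def
    proof (intro ballI allI impI)
      fix s j assume s: "s \<in> T" and j: "j < k"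
      from s consider i where "i \<in> I" "s = t i"
        | i j' where "i \<in> I" "j' < k" "s \<in> U (decimate k j' (t i))"
        by (auto simp: T_def)
      then show "decimate k j s \<in> int_module.span T"
      proof cases
        case (1 i)
        from assms(4)[OF this(1) j] show ?thesis
        proof
          assume "\<exists>i'\<in>I. decimate k j (t i) = t i'"
          then show ?thesis using 1 by (auto simp: T_def intro!: int_module.span_base)
        next
          assume "k_regular k (decimate k j (t i))"
          then show ?thesis using U(3) sub[OF 1(1) j] 1(2) by blast
        qed
      next
        case (2 i j')
        then show ?thesis using U(2) j sub[OF 2(1,2)] unfolding decimation_closed_def by blast
      qed
    qed
  qed (rule assms(1))
qed

section \<open>Constants, sums, products, periodic and polynomial sequences\<close>

lemma k_regular_const:
  assumes "2 \<le> k"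
  shows "k_regular k (\<lambda>_. c)"
  by (rule k_regular_finite_family[where I = "UNIV :: unit set" and t = "\<lambda>_ _. c"])
    (use assms in \<open>auto simp: decimate_def\<close>)

lemma k_regular_sum:
  assumes "2 \<le> k" "\<And>i. i \<in> I \<Longrightarrow> k_regular k (a i)"
  shows "k_regular k (\<lambda>n. \<Sum>i\<in>I. a i n)"
  using assms(2)
proof (induction I rule: infinite_finite_induct)
  case (insert i I)
  have "k_regular k (a i + (\<lambda>n. \<Sum>i\<in>I. a i n))"
    using insert by (intro k_regular_add) auto
  then show ?case using insert by (simp add: plus_fun_def)
qed (simp_all add: k_regular_const[OF assms(1)])

lemma k_regular_mult:
  fixes a b :: "nat \<Rightarrow> 'a::comm_ring_1"
  assumes "k_regular k a" "k_regular k b"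
  shows "k_regular k (\<lambda>n. a n * b n)"
  using k_regular_times[OF assms] by (simp add: times_fun_def)

lemma k_regular_periodic:
  fixes h :: "nat \<Rightarrow> 'a::ab_group_add"
  assumes "2 \<le> k" "M > 0"
  shows "k_regular k (\<lambda>n. h (n mod M))"
proof -
  \<comment> \<open>Substituting \<open>k n + j\<close> into \<open>u n + v\<close> gives an affine
    form again, and its coefficients matter only modulo \<open>M\<close>, so finitely many pairs
    suffice. The pair \<open>(1, 0)\<close> is in range only if \<open>M > 1\<close>.\<close>
  let ?t = "\<lambda>(u, v) n. h ((u * n + v) mod M)"
  have "k_regular k (?t (1, 0))" if "M > 1"
  proof (rule k_regular_finite_family[where I = "{..<M} \<times> {..<M}" and t = ?t])
    fix i j assume "i \<in> {..<M} \<times> {..<M}" "j < k"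
    obtain u v where i: "i = (u, v)" by fastforce
    have "(u * (k * n + j) + v) mod M = ((u * k) mod M * n + (u * j + v) mod M) mod M" for n
    proof -
      have "u * (k * n + j) + v = (u * k) * n + (u * j + v)" by (simp add: algebra_simps)
      then show ?thesis by (simp only:) (intro mod_add_cong mod_mult_cong; simp)
    qed
    then have "decimate k j (?t i) = ?t ((u * k) mod M, (u * j + v) mod M)"
      by (simp add: i decimate_def fun_eq_iff)
    moreover have "((u * k) mod M, (u * j + v) mod M) \<in> {..<M} \<times> {..<M}" using assms(2) by simp
    ultimately show "(\<exists>i'\<in>{..<M} \<times> {..<M}. decimate k j (?t i) = ?t i') \<or> k_regular k (decimate k j (?t i))"
      by blast
  qed (use assms that in auto)
  moreover have "k_regular k (\<lambda>n. h (n mod M))" if "M = 1"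
    using k_regular_const[OF assms(1)] that by simp
  ultimately show ?thesis using assms(2) by (cases "M = 1") simp_all
qed

lemma k_regular_of_nat:
  assumes "2 \<le> k"
  shows "k_regular k (of_nat :: nat \<Rightarrow> 'a::comm_ring_1)"
proof (rule k_regularI[OF assms, of "{of_nat, \<lambda>_. 1}"])
  have "decimate k j of_nat = int_scale (int k) of_nat + int_scale (int j) (\<lambda>_. 1 :: 'a)" for j
    by (simp add: decimate_def fun_eq_iff int_scale_fun int_scale_of_int)
  moreover have "decimate k j (\<lambda>_. 1) = (\<lambda>_. 1 :: 'a)" for j
    by (simp add: decimate_def fun_eq_iff)
  ultimately have "decimate k j t \<in> int_module.span {of_nat, \<lambda>_. 1 :: 'a}"
    if "t \<in> {of_nat, \<lambda>_. 1}" for t j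
    using that
    by (metis insertE empty_iff insertI1 insertI2 int_module.span_add int_module.span_scale int_module.span_base)
  then show "decimation_closed k {of_nat, \<lambda>_. 1 :: 'a}" by (simp add: decimation_closed_def)
qed (auto intro: int_module.span_base)

lemma k_regular_poly:
  fixes f :: "'a::comm_ring_1 poly"
  assumes "2 \<le> k"
  shows "k_regular k (\<lambda>n. poly f (of_nat n))"
proof (induction f)
  case 0
  then show ?case using k_regular_const[OF assms, of 0] by simp
next
  case (pCons c f)
  have "k_regular k ((\<lambda>_. c) + (\<lambda>n. of_nat n * poly f (of_nat n)))"
    by (intro k_regular_add k_regular_const k_regular_mult k_regular_of_nat assms pCons.IH)
  then show ?case by (simp add: plus_fun_def)
qed

section \<open>The kernel of a regular sequence\<close>

text \<open>Each member of a finite generating set is a combination of finitely many kernel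
  elements. Spanning by kernel elements matters because these are decimations of the sequence itself
  and so have an explicit form.\<close>

lemma k_regular_finite_kernel_subset:
  assumes "k_regular k a"
  obtains K where "finite K" "K \<subseteq> k_kernel k a" "k_kernel k a \<subseteq> int_module.span K"
proof -
  from assms obtain S where S: "finite S" "int_module.span S = int_module.span (k_kernel k a)"
    by (auto simp: k_regular_def)
  have "\<exists>K. finite K \<and> K \<subseteq> k_kernel k a \<and> s \<in> int_module.span K" if "s \<in> S" for s
  proof -
    have "s \<in> int_module.span (k_kernel k a)" using that S(2) int_module.span_base by blast
    then obtain t r where tr: "finite t" "t \<subseteq> k_kernel k a" "s = (\<Sum>a\<in>t. int_scale (r a) a)"
      unfolding int_module.span_explicit by blast
    moreover have "s \<in> int_module.span t"
      unfolding tr(3) by (intro int_module.span_sum int_module.span_scale int_module.span_base)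
    ultimately show ?thesis by blast
  qed
  then obtain K where K: "\<And>s. s \<in> S \<Longrightarrow> finite (K s) \<and> K s \<subseteq> k_kernel k a \<and> s \<in> int_module.span (K s)"
    by metis
  have "s \<in> int_module.span (\<Union>s\<in>S. K s)" if "s \<in> S" for s
    using K[OF that] int_module.span_mono[of "K s" "\<Union>s\<in>S. K s"] that by blast
  then have "int_module.span S \<subseteq> int_module.span (\<Union>s\<in>S. K s)"
    by (intro int_module.span_minimal int_module.subspace_span) blast
  then have "k_kernel k a \<subseteq> int_module.span (\<Union>s\<in>S. K s)"
    using S(2) int_module.span_superset by blast
  then show ?thesis using that[of "\<Union>s\<in>S. K s"] S(1) K by blast
qed

section \<open>Polynomials on the p-adic integers\<close>

lemma poly_padic_bounded:
  fixes f :: "'p::prime_card padic poly"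
  shows "\<exists>c. \<forall>x. padic_ge 0 x \<longrightarrow> padic_ge c (poly f x)"
proof (induction f)
  case (pCons a f)
  then obtain c where c: "\<And>x. padic_ge 0 x \<Longrightarrow> padic_ge c (poly f x)" by blast
  have "padic_ge (min c (padic_val a)) (poly (pCons a f) x)" if "padic_ge 0 x" for x
    using padic_ge_mult_0[OF that padic_ge_mono[OF c[OF that]]]
    by (auto intro!: padic_ge_add simp: padic_ge_def[of _ a])
  then show ?case by blast
qed simp

text \<open>Horner induction with \<open>x f(x) - y f(y) = x (f(x) - f(y)) + (x - y) f(y)\<close>.
  The constant \<open>c\<close> absorbs denominators of the coefficients.\<close>

lemma poly_padic_lipschitz:
  fixes f :: "'p::prime_card padic poly"
  shows "\<exists>c. \<forall>x y N. padic_ge 0 x \<longrightarrow> padic_ge 0 y \<longrightarrow> padic_ge N (x - y)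
    \<longrightarrow> padic_ge (N + c) (poly f x - poly f y)"
proof (induction f)
  case (pCons a f)
  then obtain c where c: "\<And>x y N. padic_ge 0 x \<Longrightarrow> padic_ge 0 y \<Longrightarrow> padic_ge N (x - y)
    \<Longrightarrow> padic_ge (N + c) (poly f x - poly f y)" by blast
  obtain d where d: "\<And>x. padic_ge 0 x \<Longrightarrow> padic_ge d (poly f x)"
    using poly_padic_bounded[of f] by blast
  have "padic_ge (N + min c d) (poly (pCons a f) x - poly (pCons a f) y)"
    if "padic_ge 0 x" "padic_ge 0 y" "padic_ge N (x - y)" for x y N
  proof -
    have "padic_ge (N + c) (x * (poly f x - poly f y))"
      by (rule padic_ge_mult_0[OF that(1) c[OF that]])
    then have "padic_ge (N + min c d) (x * (poly f x - poly f y))"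
      by (rule padic_ge_mono) simp
    moreover have "padic_ge (N + d) ((x - y) * poly f y)"
      by (rule padic_ge_mult[OF that(3) d[OF that(2)]])
    then have "padic_ge (N + min c d) ((x - y) * poly f y)"
      by (rule padic_ge_mono) simp
    moreover have "poly (pCons a f) x - poly (pCons a f) y
        = x * (poly f x - poly f y) + (x - y) * poly f y"
      by (simp add: algebra_simps)
    ultimately show ?thesis by (simp only: padic_ge_add)
  qed
  then show ?case by blast
qed simp

lemma poly_padic_continuous:
  fixes f :: "'p::prime_card padic poly"
  assumes "padic_ge 0 x"
  obtains N where "\<And>y. padic_ge 0 y \<Longrightarrow> padic_ge (int N) (y - x) \<Longrightarrow> padic_ge t (poly f y - poly f x)"
proof -
  obtain c where c: "\<And>x y N. padic_ge 0 x \<Longrightarrow> padic_ge 0 y \<Longrightarrow> padic_ge N (x - y)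
    \<Longrightarrow> padic_ge (N + c) (poly f x - poly f y)"
    using poly_padic_lipschitz[of f] by blast
  show ?thesis
    by (rule that[of "nat (t - c)"], rule padic_ge_mono[OF c]) (use assms in auto)
qed

lemma poly_padic_val_locally_constant:
  fixes f :: "'p::prime_card padic poly"
  assumes "padic_ge 0 x" "poly f x \<noteq> 0"
  obtains N where "\<And>y. padic_ge 0 y \<Longrightarrow> padic_ge (int N) (y - x)
    \<Longrightarrow> poly f y \<noteq> 0 \<and> padic_val (poly f y) = padic_val (poly f x)"
proof -
  obtain N where "\<And>y. padic_ge 0 y \<Longrightarrow> padic_ge (int N) (y - x)
    \<Longrightarrow> padic_ge (padic_val (poly f x) + 1) (poly f y - poly f x)"
    using poly_padic_continuous[OF assms(1)] by blast
  then show ?thesis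
    using padic_val_perturb[OF assms(2)] that by (metis zless_add1_eq)
qed

section \<open>Compactness of the p-adic integers\<close>

text \<open>If a property of residue balls fails for \<open>\<int>\<^sub>p\<close> and passes from all the
  children of a ball to the ball, then it fails along a nested sequence of balls,
  and these shrink to a point.\<close>

lemma padic_ball_induct:
  fixes P :: "nat \<Rightarrow> nat \<Rightarrow> bool"
  assumes step: "\<And>N j. j < CARD('p) ^ N \<Longrightarrow>
      (\<And>d. d < CARD('p) \<Longrightarrow> P (Suc N) (j + d * CARD('p) ^ N)) \<Longrightarrow> P N j"
    and base: "\<And>x :: 'p::prime_card padic. padic_ge 0 x \<Longrightarrow>
      \<exists>N. \<forall>j. padic_ge (int N) (of_nat j - x) \<longrightarrow> P N j"
  shows "P 0 0"
proof (rule ccontr)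
  assume P0: "\<not> P 0 0"
  let ?p = "CARD('p)"
  define D where "D N j = (SOME d. d < ?p \<and> \<not> P (Suc N) (j + d * ?p ^ N))" for N j
  have D: "D N j < ?p \<and> \<not> P (Suc N) (j + D N j * ?p ^ N)" if "j < ?p ^ N" "\<not> P N j" for N j
    unfolding D_def by (rule someI_ex) (use step that in blast)
  define J where "J = rec_nat 0 (\<lambda>N j. j + D N j * ?p ^ N)"
  have J0: "J 0 = 0" and JS: "\<And>N. J (Suc N) = J N + D N (J N) * ?p ^ N" by (simp_all add: J_def)
  have J: "J N < ?p ^ N \<and> \<not> P N (J N)" for N
  proof (induction N)
    case (Suc N)
    then have d: "D N (J N) < ?p" "\<not> P (Suc N) (J (Suc N))" using D by (auto simp: JS)
    have "J (Suc N) < Suc (D N (J N)) * ?p ^ N" using Suc by (simp add: JS)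
    also have "\<dots> \<le> ?p * ?p ^ N" using d(1) by (intro mult_le_mono1) simp
    finally show ?case using d(2) by simp
  qed (simp add: J0 P0)
  \<comment> \<open>The nested indices are compatible residues, so they are the truncations of one
    p-adic integer.\<close>
  have "J (Suc N) mod ?p ^ N = J N" for N using J[of N] by (simp add: JS)
  then have "int (J (Suc N)) mod int ?p ^ N = int (J N)" for N
    by (metis of_nat_mod of_nat_power)
  then have rep: "Rep_padic_int (Abs_padic_int (\<lambda>N. int (J N)) :: 'p padic_int) = (\<lambda>N. int (J N))"
    using J by (intro Abs_padic_int_inverse) (simp flip: of_nat_power)
  define x where "x = to_fract (Abs_padic_int (\<lambda>N. int (J N)) :: 'p padic_int)"
  have "padic_ge 0 x" by (auto simp: x_def padic_ge_iff)
  moreover have "padic_ge (int N) (of_nat (J N) - x)" for N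
    using padic_ge_diff_commute[OF padic_ge_Rep[of N "Abs_padic_int (\<lambda>N. int (J N)) :: 'p padic_int"]]
    by (simp add: x_def rep)
  ultimately show False using base J by blast
qed

text \<open>The restrictions of \<open>a\<close> to residue classes modulo \<open>p^N\<close> are
  examined. A class is the disjoint union of \<open>p\<close> finer classes, and on a small class
  around \<open>x\<close> the restriction is a regular sequence times a periodic indicator.\<close>

lemma k_regular_locally:
  fixes a :: "nat \<Rightarrow> 'a::comm_ring_1"
  assumes "2 \<le> k"
    and loc: "\<And>x :: 'p::prime_card padic. padic_ge 0 x \<Longrightarrow>
      \<exists>N b. k_regular k b \<and> (\<forall>n. padic_ge (int N) (of_nat n - x) \<longrightarrow> a n = b n)"
  shows "k_regular k a"
proof -
  let ?p = "CARD('p)"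
  define A where "A N j n = (if n mod ?p ^ N = j then a n else 0)" for N j n
  have "k_regular k (A 0 0)"
  proof (rule padic_ball_induct[where 'p = 'p and P = "\<lambda>N j. k_regular k (A N j)"])
    fix N j
    assume j: "j < ?p ^ N" and IH: "\<And>d. d < ?p \<Longrightarrow> k_regular k (A (Suc N) (j + d * ?p ^ N))"
    have "A N j n = (\<Sum>d<?p. A (Suc N) (j + d * ?p ^ N) n)" for n
    proof -
      \<comment> \<open>The next base-p digit \<open>q\<close> of \<open>n\<close> selects the only
        finer class that can contain \<open>n\<close>.\<close>
      define q where "q = (n mod ?p ^ Suc N) div ?p ^ N"
      have n: "n mod ?p ^ Suc N = n mod ?p ^ N + q * ?p ^ N"
        unfolding q_def using mod_mod_cancel[of "?p ^ N" "?p ^ Suc N" n]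
        by (metis add.commute div_mult_mod_eq dvd_triv_right power_Suc)
      have "n mod ?p ^ Suc N < ?p * ?p ^ N" by simp
      then have q: "q < ?p" unfolding q_def by (simp only: less_mult_imp_div_less)
      have "n mod ?p ^ Suc N = j + d * ?p ^ N \<longleftrightarrow> n mod ?p ^ N = j \<and> d = q" for d
      proof
        assume eq: "n mod ?p ^ Suc N = j + d * ?p ^ N"
        from arg_cong[OF eq, of "\<lambda>m. m mod ?p ^ N"] have "n mod ?p ^ N = j"
          using j by (simp add: n del: power_Suc)
        then show "n mod ?p ^ N = j \<and> d = q" using eq by (simp add: n del: power_Suc)
      qed (simp add: n del: power_Suc)
      then have "(\<Sum>d<?p. A (Suc N) (j + d * ?p ^ N) n)
          = (\<Sum>d<?p. if d = q then (if n mod ?p ^ N = j then a n else 0) else 0)"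
        unfolding A_def by (intro sum.cong) auto
      then show ?thesis using q by (simp add: A_def)
    qed
    then have eq: "A N j = (\<lambda>n. \<Sum>d<?p. A (Suc N) (j + d * ?p ^ N) n)" by blast
    show "k_regular k (A N j)"
      unfolding eq by (rule k_regular_sum[OF assms(1)]) (use IH in simp)
  next
    fix x :: "'p padic" assume x: "padic_ge 0 x"
    from loc[OF x] obtain N b where b: "k_regular k b"
      "\<And>n. padic_ge (int N) (of_nat n - x) \<Longrightarrow> a n = b n" by blast
    have "k_regular k (A N j)" if j: "padic_ge (int N) (of_nat j - x)" for j
    proof -
      have "A N j n = (if n mod ?p ^ N = j then 1 else 0) * b n" for n
      proof (cases "n mod ?p ^ N = j")
        case True
        then have "padic_ge (int N) (of_nat n - of_nat j :: 'p padic)"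
          unfolding padic_ge_of_nat_diff_iff by auto
        then show ?thesis using b(2) padic_ge_diff_trans[OF _ j] True by (simp add: A_def)
      qed (simp add: A_def)
      then have "A N j = (\<lambda>n. (\<lambda>i. if i = j then 1 else 0) (n mod ?p ^ N) * b n)" by auto
      then show ?thesis
        by (simp only:) (intro k_regular_mult k_regular_periodic assms(1) b(1), simp)
    qed
    then show "\<exists>N. \<forall>j. padic_ge (int N) (of_nat j - x) \<longrightarrow> k_regular k (A N j)" by blast
  qed
  moreover have "A 0 0 = a" by (simp add: A_def fun_eq_iff)
  ultimately show ?thesis by simp
qed

section \<open>Regularity from rational roots\<close>

lemma padic_reduced_eq:
  "x \<noteq> 0 \<Longrightarrow> padic_reduced l x = padic_p powi (- (int l * (padic_val x div int l))) * x"
  by (simp add: padic_reduced_def padic_val_pow_eq_div)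

lemma padic_reduced_0 [simp]: "padic_reduced l 0 = 0"
  by (simp add: padic_reduced_def)

lemma padic_reduced_unit_mult:
  assumes "u \<noteq> 0" "padic_val u = 0"
  shows "padic_reduced l (u * x) = u * padic_reduced l x"
  using assms by (cases "x = 0") (simp_all add: padic_reduced_eq padic_val_mult)

text \<open>Reduction forgets powers of \<open>p^l\<close>, so exponents of \<open>p\<close> matter
  only modulo \<open>l\<close>; this keeps the family in the next regularity proof finite.\<close>

lemma padic_reduced_shift:
  fixes x :: "'p::prime_card padic"
  assumes "1 \<le> l"
  shows "padic_reduced l (padic_p powi (int l * q) * x) = padic_reduced l x"
proof (cases "x = 0")
  case False
  have "(padic_p :: 'p padic) powi (- (int l * (q + padic_val x div int l))) * padic_p powi (int l * q)
      = padic_p powi (- (int l * (padic_val x div int l)))"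
    by (simp add: algebra_simps flip: power_int_add)
  then show ?thesis
    using False assms
    by (simp add: padic_reduced_eq padic_val_mult power_int_not_zero mult.assoc[symmetric])
qed simp

lemma padic_val_of_int_eq_0:
  assumes "\<not> int CARD('p) dvd i"
  shows "padic_val (of_int i :: 'p::prime_card padic) = 0"
proof -
  have "\<not> padic_ge 1 (of_int i :: 'p padic)"
    using padic_ge_of_int_iff[of 1 i, where 'p='p] assms by simp
  then show ?thesis using padic_ge_0_of_int[of i, where 'a='p] by (auto simp: padic_ge_def)
qed

lemma k_regular_reduced_linear_power:
  fixes a :: int and b l c e :: nat
  assumes "1 \<le> l" "c < l"
  shows "k_regular CARD('p)
    (\<lambda>n. padic_reduced l (padic_p ^ c * of_int (int b * int n - a) ^ e :: 'p::prime_card padic))"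
proof -
  let ?p = "CARD('p)"
  \<comment> \<open>The bound is stable: \<open>p a' = a - b j\<close> with
    \<open>j \<le> p - 1\<close> gives \<open>p |a'| \<le> A + A (p - 1)\<close>, hence
    \<open>|a'| \<le> A\<close>.\<close>
  define A where "A = max \<bar>a\<bar> (int b)"
  define t where "t = (\<lambda>(a, c) n.
    padic_reduced l (padic_p ^ c * of_int (int b * int n - a) ^ e :: 'p padic))"
  have p2: "2 \<le> ?p" using CARD_prime_card_gt_1[where 'p = 'p] by simp
  have "k_regular ?p (t (a, c))"
  proof (rule k_regular_finite_family[where I = "{- A..A} \<times> {..<l}" and t = t])
    fix i j assume i: "i \<in> {- A..A} \<times> {..<l}" and j: "j < ?p"
    obtain a c where ac: "i = (a, c)" "\<bar>a\<bar> \<le> A" "c < l" using i by (cases i) auto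
    show "(\<exists>i'\<in>{- A..A} \<times> {..<l}. decimate ?p j (t i) = t i') \<or> k_regular ?p (decimate ?p j (t i))"
    proof (cases "int ?p dvd int b * int j - a")
      case True
      then obtain a' where a': "int b * int j - a = int ?p * (- a')" by (metis dvdE minus_minus)
      \<comment> \<open>The \<open>e\<close>-th power contributes a factor \<open>p^e\<close>. The
        total exponent is split modulo \<open>l\<close>, and reduction removes the quotient
        part.\<close>
      define q c' where "q = (c + e) div l" and "c' = (c + e) mod l"
      have ce: "c + e = l * q + c'" by (simp add: q_def c'_def)
      have "\<bar>int b * int j\<bar> \<le> A * (int ?p - 1)"
        using j by (simp add: abs_mult A_def mult_mono)
      moreover have "int ?p * a' = a - int b * int j" using a' by simp
      ultimately have "\<bar>int ?p * a'\<bar> \<le> A * (int ?p - 1) + A"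
        using ac(2) abs_triangle_ineq4[of a "int b * int j"] by linarith
      then have "int ?p * \<bar>a'\<bar> \<le> int ?p * A" by (simp add: abs_mult algebra_simps)
      then have "\<bar>a'\<bar> \<le> A" by simp
      then have "(a', c') \<in> {- A..A} \<times> {..<l}" using assms(1) by (auto simp: c'_def)
      moreover have "decimate ?p j (t i) n = t (a', c') n" for n
      proof -
        let ?w = "of_int (int b * int n - a') :: 'p padic"
        have "int b * int (?p * n + j) - a = int ?p * (int b * int n - a')"
          using a' by (simp add: algebra_simps)
        then have "of_int (int b * int (?p * n + j) - a) = padic_p * ?w"
          by (simp only: of_int_mult of_int_of_nat_eq)
        then have "decimate ?p j (t i) n = padic_reduced l (padic_p ^ c * (padic_p * ?w) ^ e)"
          by (simp only: decimate_def t_def ac(1) prod.case)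
        also have "padic_p ^ c * (padic_p * ?w) ^ e = padic_p ^ (c + e) * ?w ^ e"
          by (simp add: power_mult_distrib power_add)
        also have "\<dots> = padic_p powi (int l * int q) * (padic_p ^ c' * ?w ^ e)"
          unfolding ce by (simp add: power_add flip: of_nat_mult)
        finally show ?thesis by (simp only: padic_reduced_shift[OF assms(1)] t_def prod.case)
      qed
      ultimately show ?thesis by blast
    next
      case False
      \<comment> \<open>Every value of the linear form in this residue class is a p-adic unit, and
        \<open>c < l\<close>, so reduction changes nothing and a polynomial sequence
        remains.\<close>
      have red: "padic_reduced l (padic_p ^ c * u ^ e) = padic_p ^ c * u ^ e"
        if "u \<noteq> 0" "padic_val u = 0" for u :: "'p padic"
        using that ac(3) by (simp add: padic_reduced_eq padic_val_mult padic_val_power)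
      let ?g = "smult (padic_p ^ c) ([:of_int (int b * int j - a), of_nat (b * ?p):] ^ e) :: 'p padic poly"
      have "decimate ?p j (t i) n = poly ?g (of_nat n)" for n
      proof -
        let ?w = "int b * int (?p * n + j) - a"
        have w: "?w = int b * int j - a + int ?p * (int b * int n)" by (simp add: algebra_simps)
        have "\<not> int ?p dvd ?w" using False unfolding w by (subst dvd_add_left_iff) simp_all
        then have v: "padic_val (of_int ?w :: 'p padic) = 0" and "?w \<noteq> 0"
          by (rule padic_val_of_int_eq_0) (metis \<open>\<not> int ?p dvd ?w\<close> dvd_0_right)
        then have "of_int ?w \<noteq> (0 :: 'p padic)" by (simp only: of_int_eq_0_iff not_False_eq_True)
        then have "padic_reduced l (padic_p ^ c * of_int ?w ^ e :: 'p padic) = padic_p ^ c * of_int ?w ^ e"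
          using v by (rule red)
        also have "\<dots> = poly ?g (of_nat n)"
          unfolding w by (simp add: poly_power algebra_simps)
        finally show ?thesis by (simp only: decimate_def t_def ac(1) prod.case)
      qed
      then have "decimate ?p j (t i) = (\<lambda>n. poly ?g (of_nat n))" by blast
      then show ?thesis using k_regular_poly[OF p2] by metis
    qed
  qed (use p2 assms(2) in \<open>auto simp: A_def\<close>)
  then show ?thesis by (simp add: t_def)
qed

text \<open>The hypothesis \<open>roots\<close> covers two situations at once: no root, with
  \<open>k\<close> arbitrary, and rational roots only, with \<open>k = p\<close>.\<close>

lemma k_regular_reduced_poly:
  fixes f :: "'p::prime_card padic poly"
  assumes "1 \<le> l" "f \<noteq> 0" "2 \<le> k"
    and roots: "\<And>x. padic_ge 0 x \<Longrightarrow> poly f x = 0 \<Longrightarrow> x \<in> \<rat> \<and> k = CARD('p)"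
  shows "k_regular k (\<lambda>n. padic_reduced l (poly f (of_nat n)))"
proof (rule k_regular_locally[where 'p = 'p, OF assms(3)])
  fix x :: "'p padic" assume x: "padic_ge 0 x"
  show "\<exists>N b. k_regular k b \<and> (\<forall>n. padic_ge (int N) (of_nat n - x) \<longrightarrow>
      padic_reduced l (poly f (of_nat n)) = b n)"
  proof (cases "poly f x = 0")
    case False
    obtain N where N: "\<And>y. padic_ge 0 y \<Longrightarrow> padic_ge (int N) (y - x)
      \<Longrightarrow> poly f y \<noteq> 0 \<and> padic_val (poly f y) = padic_val (poly f x)"
      using poly_padic_val_locally_constant[OF x False] by blast
    let ?g = "smult (padic_p powi (- (int l * (padic_val (poly f x) div int l)))) f"
    have "padic_reduced l (poly f (of_nat n)) = poly ?g (of_nat n)"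
      if "padic_ge (int N) (of_nat n - x)" for n
      using N[OF _ that] by (simp add: padic_reduced_eq)
    then show ?thesis using k_regular_poly[OF assms(3), of ?g] by blast
  next
    case True
    from roots[OF x True] have "x \<in> \<rat>" and k: "k = CARD('p)" by auto
    then obtain a b' where ab': "b' > 0" "x = of_int a / of_int b'" by (metis Rats_cases')
    define b where "b = nat b'"
    have ab: "b > 0" "x = of_int a / of_nat b" using ab' by (simp_all add: b_def)
    define e where "e = order x f"
    obtain h where h: "f = [:- x, 1:] ^ e * h" "\<not> [:- x, 1:] dvd h"
      using order_decomp[OF assms(2), of x] by (auto simp: e_def)
    have hx: "poly h x \<noteq> 0" using h(2) by (simp add: poly_eq_0_iff_dvd)
    obtain N where N: "\<And>y. padic_ge 0 y \<Longrightarrow> padic_ge (int N) (y - x)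
      \<Longrightarrow> poly h y \<noteq> 0 \<and> padic_val (poly h y) = padic_val (poly h x)"
      using poly_padic_val_locally_constant[OF x hx] by blast
    let ?B = "of_nat b :: 'p padic"
    have B: "?B \<noteq> 0" using ab(1) by simp
    \<comment> \<open>This exponent gives \<open>f(n) = g(n) p^C (b n - a)^e\<close> near
      \<open>x\<close> with \<open>g(n)\<close> of valuation zero. Such a factor passes through
      reduction, and \<open>C\<close> may then be replaced by its residue \<open>c\<close> modulo
      \<open>l\<close>.\<close>
    define C where "C = padic_val (poly h x) - int e * padic_val ?B"
    define c where "c = nat (C mod int l)"
    have C: "C = int l * (C div int l) + int c" using assms(1) by (simp add: c_def)
    have c: "c < l" using assms(1) by (simp add: c_def nat_less_iff)
    let ?g = "smult (padic_p powi (- C) / ?B ^ e) h"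
    let ?H = "\<lambda>n. padic_reduced l (padic_p ^ c * of_int (int b * int n - a) ^ e :: 'p padic)"
    have "padic_reduced l (poly f (of_nat n)) = poly ?g (of_nat n) * ?H n"
      if "padic_ge (int N) (of_nat n - x)" for n
    proof -
      let ?w = "of_int (int b * int n - a) :: 'p padic"
      from N[OF _ that] have hn: "poly h (of_nat n) \<noteq> 0"
        "padic_val (poly h (of_nat n)) = padic_val (poly h x)" by auto
      have g0: "poly ?g (of_nat n) \<noteq> 0" using hn(1) B by (simp add: power_int_not_zero)
      have "padic_val (poly ?g (of_nat n) * ?B ^ e) = padic_val (padic_p powi (- C) * poly h (of_nat n))"
        using B by simp
      then have "padic_val (poly ?g (of_nat n)) + int e * padic_val ?B = - C + padic_val (poly h x)"
        using g0 B hn by (simp only: padic_val_mult padic_val_power padic_val_p_powi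
            power_not_zero power_int_not_zero padic_p_nonzero not_False_eq_True simp_thms)
      then have gv: "padic_val (poly ?g (of_nat n)) = 0" by (simp add: C_def)
      have "of_nat n - x = ?w / ?B" using B by (simp add: ab(2) field_simps)
      then have "poly f (of_nat n) = (?w / ?B) ^ e * poly h (of_nat n)"
        by (simp add: h(1) poly_power)
      also have "\<dots> = poly ?g (of_nat n) * (padic_p powi C * ?w ^ e)"
        by (simp add: power_divide power_int_minus)
      also have "padic_p powi C * ?w ^ e = padic_p powi (int l * (C div int l)) * (padic_p ^ c * ?w ^ e)"
        by (subst C) (simp add: power_int_add)
      finally show ?thesis
        by (simp only: padic_reduced_unit_mult[OF g0 gv] padic_reduced_shift[OF assms(1)])
    qed
    moreover have "k_regular k (\<lambda>n. poly ?g (of_nat n) * ?H n)"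
      unfolding k
      by (intro k_regular_mult k_regular_poly k_regular_reduced_linear_power assms(1) c)
        (use assms(3) k in simp)
    ultimately show ?thesis by blast
  qed
qed

section \<open>Singular points of a sequence\<close>

text \<open>The existence of a limit as \<open>n\<close> tends p-adically to \<open>y\<close>, in
  Cauchy form, so that no limit value has to be named.\<close>

definition padic_cauchy_at :: "'p::prime_card padic \<Rightarrow> (nat \<Rightarrow> 'p padic) \<Rightarrow> bool" where
  "padic_cauchy_at y a \<longleftrightarrow> (\<forall>t. \<exists>N. \<forall>m n. padic_ge (int N) (of_nat m - y)
      \<longrightarrow> padic_ge (int N) (of_nat n - y) \<longrightarrow> padic_ge t (a m - a n))"

lemma padic_cauchy_at_zero: "padic_cauchy_at y 0"
  by (simp add: padic_cauchy_at_def)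

lemma padic_cauchy_at_add:
  assumes "padic_cauchy_at y a" "padic_cauchy_at y b"
  shows "padic_cauchy_at y (a + b)"
  unfolding padic_cauchy_at_def
proof
  fix t
  obtain M where M: "\<And>m n. padic_ge (int M) (of_nat m - y) \<Longrightarrow> padic_ge (int M) (of_nat n - y)
      \<Longrightarrow> padic_ge t (a m - a n)"
    using assms(1) unfolding padic_cauchy_at_def by blast
  obtain N where N: "\<And>m n. padic_ge (int N) (of_nat m - y) \<Longrightarrow> padic_ge (int N) (of_nat n - y)
      \<Longrightarrow> padic_ge t (b m - b n)"
    using assms(2) unfolding padic_cauchy_at_def by blast
  have "padic_ge t ((a + b) m - (a + b) n)"
    if "padic_ge (int (max M N)) (of_nat m - y)" "padic_ge (int (max M N)) (of_nat n - y)" for m n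
  proof -
    have "padic_ge t ((a m - a n) + (b m - b n))"
      using M N that[THEN padic_ge_mono] by (intro padic_ge_add) auto
    then show ?thesis by (simp add: algebra_simps)
  qed
  then show "\<exists>N. \<forall>m n. padic_ge (int N) (of_nat m - y) \<longrightarrow> padic_ge (int N) (of_nat n - y)
      \<longrightarrow> padic_ge t ((a + b) m - (a + b) n)" by blast
qed

lemma padic_cauchy_at_scale:
  assumes "padic_cauchy_at y a"
  shows "padic_cauchy_at y (int_scale c a)"
proof -
  have "padic_ge t (int_scale c a m - int_scale c a n)" if "padic_ge t (a m - a n)" for t m n
    using padic_ge_mult_0[OF padic_ge_0_of_int that, of c]
    unfolding int_scale_fun unfolding int_scale_of_int by (simp add: right_diff_distrib)
  then show ?thesis using assms unfolding padic_cauchy_at_def by meson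
qed

lemma padic_cauchy_at_span:
  assumes "a \<in> int_module.span K" "\<And>b. b \<in> K \<Longrightarrow> padic_cauchy_at y b"
  shows "padic_cauchy_at y a"
  using assms(1)
proof (induction rule: int_module.span_induct_alt)
  case base
  show ?case by (rule padic_cauchy_at_zero)
next
  case (step c b d)
  show ?case
    by (intro padic_cauchy_at_add padic_cauchy_at_scale assms(2) step)
qed

lemma padic_cauchy_at_reduced_poly:
  fixes g :: "'p::prime_card padic poly"
  assumes y: "padic_ge 0 y" and "poly g y \<noteq> 0"
  shows "padic_cauchy_at y (\<lambda>n. padic_reduced l (poly g (of_nat n)))"
  unfolding padic_cauchy_at_def
proof
  fix t
  \<comment> \<open>Near \<open>y\<close> reduction is multiplication by \<open>p^d\<close>, so
    precision \<open>t - d\<close> for the polynomial yields precision \<open>t\<close>.\<close>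
  define d where "d = - (int l * (padic_val (poly g y) div int l))"
  obtain M where M: "\<And>z. padic_ge 0 z \<Longrightarrow> padic_ge (int M) (z - y)
      \<Longrightarrow> poly g z \<noteq> 0 \<and> padic_val (poly g z) = padic_val (poly g y)"
    using poly_padic_val_locally_constant[OF assms] by blast
  obtain N where N: "\<And>z. padic_ge 0 z \<Longrightarrow> padic_ge (int N) (z - y)
      \<Longrightarrow> padic_ge (t - d) (poly g z - poly g y)"
    using poly_padic_continuous[OF y] by blast
  have "padic_ge t (padic_reduced l (poly g (of_nat m)) - padic_reduced l (poly g (of_nat n)))"
    if "padic_ge (int (max M N)) (of_nat m - y)" "padic_ge (int (max M N)) (of_nat n - y)" for m n
  proof -
    have red: "padic_reduced l (poly g (of_nat k)) = padic_p powi d * poly g (of_nat k)"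
      if "padic_ge (int (max M N)) (of_nat k - y)" for k
      using M[of "of_nat k"] padic_ge_mono[OF that, of "int M"] by (simp add: padic_reduced_eq d_def)
    have "padic_ge (t - d) (poly g (of_nat k) - poly g y)"
      if "padic_ge (int (max M N)) (of_nat k - y)" for k
      by (rule N) (use padic_ge_mono[OF that, of "int N"] in simp_all)
    from padic_ge_diff_trans[OF this[OF that(1)] padic_ge_diff_commute[OF this[OF that(2)]]]
    have "padic_ge (t - d) (poly g (of_nat m) - poly g (of_nat n))" .
    then have "padic_ge (d + (t - d)) (padic_p powi d * (poly g (of_nat m) - poly g (of_nat n)))"
      by (intro padic_ge_mult) simp_all
    then show ?thesis by (simp add: red that right_diff_distrib)
  qed
  then show "\<exists>N. \<forall>m n. padic_ge (int N) (of_nat m - y) \<longrightarrow> padic_ge (int N) (of_nat n - y) \<longrightarrow>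
      padic_ge t (padic_reduced l (poly g (of_nat m)) - padic_reduced l (poly g (of_nat n)))"
    by blast
qed

section \<open>Failure of the Cauchy property at the roots\<close>

lemma padic_ge_power_diff:
  assumes "padic_ge 0 x" "padic_ge 0 y" "padic_ge t (x - y)"
  shows "padic_ge t (x ^ n - y ^ n)"
proof (induction n)
  case (Suc n)
  have "x ^ Suc n - y ^ Suc n = x * (x ^ n - y ^ n) + y ^ n * (x - y)"
    by (simp add: algebra_simps)
  then show ?case
    using padic_ge_mult_0[OF assms(1) Suc] padic_ge_mult_0[OF padic_ge_0_power[OF assms(2)] assms(3)]
    by (simp only: padic_ge_add)
qed simp

text \<open>Near a root \<open>y\<close> of order \<open>e\<close>, the values at \<open>y + p\<^sup>N\<close> and at \<open>y + (1 + p) p\<^sup>N\<close> have the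
  same valuation, and their quotient is close to \<open>(1 + p)\<^sup>e \<noteq> 1\<close> for all large \<open>N\<close>.\<close>

lemma not_padic_cauchy_at_root:
  fixes g :: "'p::prime_card padic poly"
  assumes l: "1 \<le> l" and "g \<noteq> 0" and y: "padic_ge 0 y" and root: "poly g y = 0"
  shows "\<not> padic_cauchy_at y (\<lambda>n. padic_reduced l (poly g (of_nat n)))"
proof
  assume cauchy: "padic_cauchy_at y (\<lambda>n. padic_reduced l (poly g (of_nat n)))"
  let ?p = "padic_p :: 'p padic"
  define e where "e = order y g"
  have e: "e \<noteq> 0" using assms(2) root by (simp add: e_def order_root)
  obtain h where h: "g = [:- y, 1:] ^ e * h" "\<not> [:- y, 1:] dvd h"
    using order_decomp[OF assms(2), of y] by (auto simp: e_def)
  have hy: "poly h y \<noteq> 0" using h(2) by (simp add: poly_eq_0_iff_dvd)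
  define C where "C = padic_val (poly h y)"
  \<comment> \<open>The limiting relative difference of the values at the two points. It is nonzero
    as \<open>e > 0\<close>, and its valuation \<open>D\<close> fixes the precision required
    below.\<close>
  define \<Delta> where "\<Delta> = (1 + ?p) ^ e - 1"
  have "(1 + CARD('p)) ^ e \<noteq> 1" using e by simp
  then have "of_nat ((1 + CARD('p)) ^ e) \<noteq> (of_nat 1 :: 'p padic)" by (simp only: of_nat_eq_iff not_False_eq_True)
  then have \<Delta>: "\<Delta> \<noteq> 0" by (simp add: \<Delta>_def)
  define D where "D = padic_val \<Delta>"
  have "padic_ge 0 \<Delta>" unfolding \<Delta>_def
    by (intro padic_ge_diff padic_ge_0_power padic_ge_add) (simp_all add: padic_ge_def[of 0 1])
  then have D: "D \<ge> 0" using \<Delta> by (simp add: padic_ge_def D_def)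
  \<comment> \<open>A nonzero reduced value has valuation at most \<open>l - 1\<close>, so a
    difference of relative valuation \<open>D\<close> cannot reach \<open>l + D\<close>.\<close>
  obtain N1 where N1: "\<And>m n. padic_ge (int N1) (of_nat m - y) \<Longrightarrow> padic_ge (int N1) (of_nat n - y)
      \<Longrightarrow> padic_ge (int l + D) (padic_reduced l (poly g (of_nat m)) - padic_reduced l (poly g (of_nat n)))"
    using cauchy unfolding padic_cauchy_at_def by blast
  obtain N2 where N2: "\<And>z. padic_ge 0 z \<Longrightarrow> padic_ge (int N2) (z - y)
      \<Longrightarrow> padic_ge (C + D + 1) (poly h z - poly h y)"
    using poly_padic_continuous[OF y] by blast
  define N where "N = max N1 N2"
  \<comment> \<open>One digit beyond \<open>D\<close>, so that replacing \<open>s\<close> by an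
    approximation \<open>w\<close> does not disturb the main term. \<open>V\<close> is the valuation
    of \<open>g\<close> at the points constructed in \<open>near\<close>.\<close>
  define K where "K = nat D + 1"
  define V where "V = int N * int e + C"
  have near: "\<exists>n w. padic_ge (int N) (of_nat n - y) \<and> padic_val w = 0 \<and> w \<noteq> 0 \<and> padic_ge 0 w \<and>
      padic_ge (int K) (w - s) \<and> padic_ge (C + D + 1) (poly h (of_nat n) - poly h y) \<and>
      padic_reduced l (poly g (of_nat n)) = ?p powi (int N * int e - int l * (V div int l)) * w ^ e * poly h (of_nat n)"
    if s: "padic_ge 0 s" "s \<noteq> 0" "padic_val s = 0" for s
  proof -
    \<comment> \<open>The number \<open>n\<close> is chosen to match \<open>y + p^N s\<close> to
      \<open>N + K\<close> digits; dividing \<open>n - y\<close> by \<open>p^N\<close> leaves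
      \<open>K\<close> correct digits of \<open>s\<close>.\<close>
    have "padic_ge 0 (y + ?p ^ N * s)" using y s(1) by (intro padic_ge_add padic_ge_mult_0) simp_all
    then obtain n where n: "padic_ge (int (N + K)) (of_nat n - (y + ?p ^ N * s))"
      using padic_integer_approx by blast
    define w where "w = (of_nat n - y) / ?p ^ N"
    have nw: "of_nat n - y = ?p ^ N * w" by (simp add: w_def)
    have "of_nat n - (y + ?p ^ N * s) = ?p ^ N * (w - s)" using nw by (simp add: algebra_simps)
    then have ws: "padic_ge (int K) (w - s)"
      using padic_ge_cancel[of "?p ^ N" "int (N + K)" "w - s"] n by simp
    then have w: "w \<noteq> 0" "padic_val w = 0"
      using padic_val_perturb[OF s(2), of "int K" w] s(3) by (simp_all add: K_def)
    have w0: "padic_ge 0 w" using w(2) by (simp add: padic_ge_def)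
    have near: "padic_ge (int N) (of_nat n - y)"
      unfolding nw using padic_ge_mult[OF _ w0, of "int N" "?p ^ N"] by simp
    then have hn: "padic_ge (C + D + 1) (poly h (of_nat n) - poly h y)"
      by (intro N2) (auto intro: padic_ge_mono simp: N_def)
    then have hn': "poly h (of_nat n) \<noteq> 0" "padic_val (poly h (of_nat n)) = C"
      using padic_val_perturb[OF hy] D by (auto simp: C_def)
    have gn: "poly g (of_nat n) = (?p ^ N * w) ^ e * poly h (of_nat n)"
      by (simp add: h(1) poly_power flip: nw)
    have "padic_val (poly g (of_nat n)) = V" "poly g (of_nat n) \<noteq> 0"
      unfolding gn using w hn' by (simp_all add: padic_val_mult padic_val_power V_def)
    then have "padic_reduced l (poly g (of_nat n)) = ?p powi (- (int l * (V div int l))) * poly g (of_nat n)"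
      by (simp add: padic_reduced_eq)
    also have "\<dots> = ?p powi (int N * int e - int l * (V div int l)) * w ^ e * poly h (of_nat n)"
      unfolding gn by (simp add: power_mult_distrib power_int_diff power_int_minus field_simps power_int_mult)
    finally show ?thesis using near w w0 ws hn by blast
  qed
  have s1: "padic_ge 0 (1 :: 'p padic)" by (simp add: padic_ge_def)
  have s2: "padic_ge 0 (1 + ?p)" by (intro padic_ge_add s1) simp
  have s3: "1 + ?p \<noteq> 0" "padic_val (1 + ?p) = 0"
    using padic_val_perturb[of "1 :: 'p padic" 1 "1 + ?p"] padic_ge_p_power[of 1 1, where 'p='p] by simp_all
  obtain n w where n: "padic_ge (int N) (of_nat n - y)" "padic_val w = 0" "w \<noteq> 0" "padic_ge 0 w"
    "padic_ge (int K) (w - 1)" "padic_ge (C + D + 1) (poly h (of_nat n) - poly h y)"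
    "padic_reduced l (poly g (of_nat n)) = ?p powi (int N * int e - int l * (V div int l)) * w ^ e * poly h (of_nat n)"
    using near[OF s1] by auto
  obtain m v where m: "padic_ge (int N) (of_nat m - y)" "padic_val v = 0" "v \<noteq> 0" "padic_ge 0 v"
    "padic_ge (int K) (v - (1 + ?p))" "padic_ge (C + D + 1) (poly h (of_nat m) - poly h y)"
    "padic_reduced l (poly g (of_nat m)) = ?p powi (int N * int e - int l * (V div int l)) * v ^ e * poly h (of_nat m)"
    using near[OF s2 s3] by auto
  \<comment> \<open>The main term of \<open>E\<close> is \<open>h(y) \<Delta>\<close>, of valuation
    \<open>C + D\<close>. \<open>X\<close> collects the errors in \<open>h\<close> and
    \<open>Y\<close> those in the powers, both divisible by \<open>p^(C + D + 1)\<close>.\<close>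
  define E where "E = v ^ e * poly h (of_nat m) - w ^ e * poly h (of_nat n)"
  define X where "X = v ^ e * (poly h (of_nat m) - poly h y) - w ^ e * (poly h (of_nat n) - poly h y)"
  define Y where "Y = poly h y * ((v ^ e - (1 + ?p) ^ e) - (w ^ e - 1 ^ e))"
  have "E - poly h y * \<Delta> = X + Y" by (simp add: E_def X_def Y_def \<Delta>_def algebra_simps)
  moreover have "padic_ge (C + D + 1) X"
    unfolding X_def by (intro padic_ge_diff padic_ge_mult_0 padic_ge_0_power n m)
  moreover have "padic_ge (C + (D + 1)) Y"
    unfolding Y_def
  proof (rule padic_ge_mult)
    have "int K = D + 1" using D by (simp add: K_def)
    then show "padic_ge (D + 1) ((v ^ e - (1 + ?p) ^ e) - (w ^ e - 1 ^ e))"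
      using padic_ge_diff[OF padic_ge_power_diff[OF m(4) s2 m(5)] padic_ge_power_diff[OF n(4) s1 n(5)]]
      by simp
  qed (simp add: padic_ge_def C_def)
  ultimately have "padic_ge (C + D + 1) (E - poly h y * \<Delta>)"
    by (simp only: add.assoc padic_ge_add)
  moreover have "poly h y * \<Delta> \<noteq> 0" "padic_val (poly h y * \<Delta>) = C + D"
    using hy \<Delta> by (simp_all add: padic_val_mult C_def D_def)
  ultimately have E: "E \<noteq> 0" "padic_val E = C + D"
    using padic_val_perturb[of "poly h y * \<Delta>" "C + D + 1" E] by simp_all
  have "padic_ge (int l + D) (padic_reduced l (poly g (of_nat m)) - padic_reduced l (poly g (of_nat n)))"
    using n(1) m(1) by (intro N1) (auto intro: padic_ge_mono simp: N_def)
  then have "padic_ge (int l + D) (?p powi (int N * int e - int l * (V div int l)) * E)"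
    unfolding n(7) m(7) E_def by (simp add: algebra_simps)
  then have "int l + D \<le> int N * int e - int l * (V div int l) + (C + D)"
    using E by (simp add: padic_ge_def padic_val_mult power_int_not_zero)
  \<comment> \<open>Since \<open>V = N e + C\<close>, the exponent of \<open>p\<close> together with
    \<open>C\<close> is exactly \<open>V mod l\<close>.\<close>
  then have "int l \<le> V mod int l" by (simp add: V_def minus_mult_div_eq_mod[symmetric])
  moreover have "V mod int l < int l" using l by simp
  ultimately show False by simp
qed

text \<open>Finitely many nonzero polynomials belong to a finite spanning set of kernel elements.
  Away from their zeros the Cauchy property passes to the whole kernel, while it fails at every
  shifted root.\<close>

lemma k_regular_reduced_poly_finite_shifted_roots:
  fixes f :: "'p::prime_card padic poly"
  assumes l: "1 \<le> l" and "f \<noteq> 0" and reg: "k_regular k (\<lambda>n. padic_reduced l (poly f (of_nat n)))"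
  shows "finite {y. padic_ge 0 y \<and> (\<exists>i j. j < k ^ i \<and> poly f (of_nat (k ^ i) * y + of_nat j) = 0)}"
proof -
  let ?s = "\<lambda>n. padic_reduced l (poly f (of_nat n))"
  define F where "F i j = f \<circ>\<^sub>p [:of_nat j, of_nat (k ^ i):]" for i j
  have k: "2 \<le> k" using reg by (simp add: k_regular_def)
  have F0: "F i j \<noteq> 0" for i j
    using assms(2) k by (simp add: F_def pcompose_eq_0_iff)
  have polyF: "poly (F i j) x = poly f (of_nat (k ^ i) * x + of_nat j)" for i j x
    by (simp add: F_def poly_pcompose algebra_simps)
  have dec: "decimate (k ^ i) j ?s = (\<lambda>n. padic_reduced l (poly (F i j) (of_nat n)))" for i j
    by (rule ext) (simp only: polyF decimate_def of_nat_add of_nat_mult)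
  obtain K where K: "finite K" "K \<subseteq> k_kernel k ?s" "k_kernel k ?s \<subseteq> int_module.span K"
    by (rule k_regular_finite_kernel_subset[OF reg])
  have "\<exists>g. g \<noteq> 0 \<and> b = (\<lambda>n. padic_reduced l (poly g (of_nat n)))" if "b \<in> K" for b
  proof -
    from that K(2) have "b \<in> k_kernel k ?s" by blast
    then obtain i j where "b = decimate (k ^ i) j ?s" unfolding k_kernel_iff by blast
    then show ?thesis using F0[of i j] dec[of i j] by metis
  qed
  then obtain G where G: "\<And>b. b \<in> K \<Longrightarrow> G b \<noteq> 0"
    "\<And>b. b \<in> K \<Longrightarrow> b = (\<lambda>n. padic_reduced l (poly (G b) (of_nat n)))" by metis
  have "y \<in> (\<Union>b\<in>K. {y. poly (G b) y = 0})"
    if y: "padic_ge 0 y" "j < k ^ i" "poly f (of_nat (k ^ i) * y + of_nat j) = 0" for y i j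
  proof (rule ccontr)
    assume "y \<notin> (\<Union>b\<in>K. {y. poly (G b) y = 0})"
    then have "padic_cauchy_at y b" if "b \<in> K" for b
      using padic_cauchy_at_reduced_poly[OF y(1)] G(2)[OF that] that by (metis (mono_tags) UN_I mem_Collect_eq)
    moreover have "decimate (k ^ i) j ?s \<in> int_module.span K"
      using K(3) y(2) k_kernel_iff by blast
    ultimately have "padic_cauchy_at y (decimate (k ^ i) j ?s)" using padic_cauchy_at_span by blast
    then show False
      using not_padic_cauchy_at_root[OF l F0 y(1)] y(3) unfolding dec polyF by blast
  qed
  then have "{y. padic_ge 0 y \<and> (\<exists>i j. j < k ^ i \<and> poly f (of_nat (k ^ i) * y + of_nat j) = 0)}
      \<subseteq> (\<Union>b\<in>K. {y. poly (G b) y = 0})" by blast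
  then show ?thesis
    by (rule finite_subset) (use K(1) G(1) poly_roots_finite in blast)
qed

section \<open>Shifts of a root\<close>

text \<open>For every \<open>i\<close> there is a decomposition \<open>x = k^i Y_i + J_i\<close>
  with \<open>Y_i\<close> a shifted root. Finiteness forces \<open>Y_a = Y_b\<close> for some
  \<open>a \<noteq> b\<close>, and the two linear equations then determine this value as a rational
  number.\<close>

lemma k_regular_roots_rational:
  fixes f :: "'p::prime_card padic poly"
  assumes l: "1 \<le> l" and f: "f \<noteq> 0" and reg: "k_regular k (\<lambda>n. padic_reduced l (poly f (of_nat n)))"
    and x: "padic_ge 0 x" "poly f x = 0"
  shows "x \<in> \<rat>"
proof -
  let ?Y = "{y. padic_ge 0 y \<and> (\<exists>i j. j < k ^ i \<and> poly f (of_nat (k ^ i) * y + of_nat j) = 0)}"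
  have k: "2 \<le> k" using reg by (simp add: k_regular_def)
  have "\<exists>j y. j < k ^ i \<and> padic_ge 0 y \<and> x = of_nat (k ^ i) * y + of_nat j" for i
  proof -
    \<comment> \<open>Only the \<open>p\<close>-part of \<open>k^i\<close> obstructs integrality of
      the quotient, so an index below \<open>p^u\<close> agreeing with \<open>x\<close> modulo
      \<open>p^u\<close> suffices.\<close>
    define u where "u = multiplicity CARD('p) (k ^ i)"
    have "k ^ i \<noteq> 0" using k by simp
    then obtain r where r: "k ^ i = CARD('p) ^ u * r" "\<not> CARD('p) dvd r"
      unfolding u_def by (rule multiplicity_decompose') (use prime_card[where 'a='p] not_prime_unit in blast)
    have r0: "r \<noteq> 0" using r(2) by (metis dvd_0_right)
    obtain j where j: "j < CARD('p) ^ u" "padic_ge (int u) (of_nat j - x)"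
      by (rule padic_integer_approx[OF x(1)])
    define y where "y = (x - of_nat j) / of_nat (k ^ i)"
    have "padic_val (of_nat r :: 'p padic) = 0"
      using padic_val_of_int_eq_0[of "int r", where 'p='p] r(2) by simp
    then have "padic_val (of_nat (k ^ i) :: 'p padic) = int u"
      using r0 by (simp add: r(1) padic_val_mult)
    moreover have xy: "x - of_nat j = of_nat (k ^ i) * y" using k by (simp add: y_def)
    ultimately have "padic_ge 0 y"
      using padic_ge_diff_commute[OF j(2)] k by (cases "y = 0") (simp_all add: padic_ge_def padic_val_mult)
    moreover have "j < k ^ i" using j(1) r(1) r0 by (cases r) auto
    moreover have "x = of_nat (k ^ i) * y + of_nat j" using xy by (simp add: algebra_simps)
    ultimately show ?thesis by blast
  qed
  then obtain J Y where JY: "\<And>i. J i < k ^ i" "\<And>i. padic_ge 0 (Y i)"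
    "\<And>i. x = of_nat (k ^ i) * Y i + of_nat (J i)" by metis
  have "range Y \<subseteq> ?Y" using JY x(2) by auto metis
  then have "finite (range Y)"
    by (rule finite_subset) (rule k_regular_reduced_poly_finite_shifted_roots[OF l f reg])
  then have "\<not> inj Y" using finite_imageD infinite_UNIV_nat by blast
  then obtain a b where ab: "Y a = Y b" "a \<noteq> b" by (auto simp: inj_on_def)
  have neq: "of_nat (k ^ a) - of_nat (k ^ b) \<noteq> (0 :: 'p padic)"
  proof -
    have "k ^ a \<noteq> k ^ b" using ab(2) k by simp
    then show ?thesis by (simp only: right_minus_eq of_nat_eq_iff not_False_eq_True)
  qed
  have "Y a * (of_nat (k ^ a) - of_nat (k ^ b)) = of_nat (J b) - of_nat (J a)"
    using JY(3)[of a] JY(3)[of b] ab(1) by (simp add: algebra_simps)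
  then have "Y a = (of_nat (J b) - of_nat (J a)) / (of_nat (k ^ a) - of_nat (k ^ b))"
    using neq by (simp add: eq_divide_eq)
  then have "Y a \<in> \<rat>" by simp
  then show ?thesis by (subst JY(3)[of a]) simp
qed

text \<open>If \<open>k = p^u r\<close> with \<open>r\<close> prime to \<open>p\<close> and
  \<open>r \<ge> 2\<close>, a single root yields \<open>r^i\<close> distinct shifted roots at level
  \<open>i\<close>, contradicting finiteness.\<close>

lemma k_regular_root_base:
  fixes f :: "'p::prime_card padic poly"
  assumes l: "1 \<le> l" and f: "f \<noteq> 0" and reg: "k_regular k (\<lambda>n. padic_reduced l (poly f (of_nat n)))"
    and x: "padic_ge 0 x" "poly f x = 0"
  shows "\<not> mult_indep CARD('p) k"
proof
  assume indep: "mult_indep CARD('p) k"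
  let ?Y = "{y. padic_ge 0 y \<and> (\<exists>i j. j < k ^ i \<and> poly f (of_nat (k ^ i) * y + of_nat j) = 0)}"
  have k: "2 \<le> k" using reg by (simp add: k_regular_def)
  have p: "prime CARD('p)" by (rule prime_card)
  define u where "u = multiplicity CARD('p) k"
  have "k \<noteq> 0" using k by simp
  then obtain r where r: "k = CARD('p) ^ u * r" "\<not> CARD('p) dvd r"
    unfolding u_def by (rule multiplicity_decompose') (use p not_prime_unit in blast)
  have "r \<noteq> 1"
  proof
    assume "r = 1"
    then have "CARD('p) ^ u = k ^ 1" "u \<ge> 1" using r(1) k by (auto simp: Suc_le_eq intro!: Nat.gr0I)
    then show False using indep unfolding mult_indep_def by blast
  qed
  moreover have "r \<noteq> 0" using r(2) by (metis dvd_0_right)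
  ultimately have r2: "r \<ge> 2" by simp
  have fin: "finite ?Y" by (rule k_regular_reduced_poly_finite_shifted_roots[OF l f reg])
  \<comment> \<open>This level suffices because \<open>r^i \<ge> 2^i > i\<close>.\<close>
  define i where "i = card ?Y"
  let ?q = "CARD('p) ^ (u * i)"
  have ki: "k ^ i = ?q * r ^ i" by (simp add: r(1) power_mult_distrib power_mult)
  obtain j where j: "j < ?q" "padic_ge (int (u * i)) (of_nat j - x)"
    by (rule padic_integer_approx[OF x(1)])
  \<comment> \<open>The admissible indices below \<open>k^i = p^(u i) r^i\<close> are those
    congruent to \<open>x\<close> modulo \<open>p^(u i)\<close>, one for each
    \<open>t < r^i\<close>.\<close>
  define y where "y t = (x - of_nat (j + ?q * t)) / of_nat (k ^ i)" for t
  have q0: "of_nat (k ^ i) \<noteq> (0 :: 'p padic)" using k by simp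
  have "\<not> CARD('p) dvd r ^ i" using r(2) p prime_dvd_power by blast
  then have "padic_val (of_nat (r ^ i) :: 'p padic) = 0"
    using padic_val_of_int_eq_0[of "int (r ^ i)", where 'p='p]
    by (metis int_dvd_int_iff of_int_of_nat_eq)
  then have val: "padic_val (of_nat (k ^ i) :: 'p padic) = int (u * i)"
    unfolding ki of_nat_mult using \<open>r \<noteq> 0\<close> by (subst padic_val_mult) simp_all
  have "y t \<in> ?Y" if "t < r ^ i" for t
  proof -
    have xy: "x - of_nat (j + ?q * t) = of_nat (k ^ i) * y t" using q0 by (simp add: y_def)
    have "padic_ge (int (u * i)) ((x - of_nat j) - of_nat t * padic_p ^ (u * i))"
      by (intro padic_ge_diff padic_ge_diff_commute[OF j(2)] padic_ge_mult_0) simp_all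
    also have "(x - of_nat j) - of_nat t * padic_p ^ (u * i) = of_nat (k ^ i) * y t"
      unfolding xy[symmetric] by simp
    finally have "padic_ge 0 (y t)"
      using padic_ge_cancel[OF q0] val by (metis cancel_comm_monoid_add_class.diff_cancel)
    moreover have "j + ?q * t < ?q * Suc t" using j(1) by simp
    then have "j + ?q * t < k ^ i"
      using mult_le_mono2[of "Suc t" "r ^ i" ?q] that unfolding ki by linarith
    moreover have "of_nat (k ^ i) * y t + of_nat (j + ?q * t) = x" using xy by (simp add: algebra_simps)
    then have "poly f (of_nat (k ^ i) * y t + of_nat (j + ?q * t)) = 0" using x(2) by simp
    ultimately show ?thesis by blast
  qed
  moreover have "inj_on y {..<r ^ i}"
    using q0 by (auto simp: inj_on_def y_def simp del: of_nat_power)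
  ultimately have "card {..<r ^ i} \<le> card ?Y" by (intro card_inj_on_le[of y] fin) auto
  then have "r ^ i \<le> i" by (simp add: i_def)
  moreover have "i < 2 ^ i" by (rule less_exp)
  moreover have "(2::nat) ^ i \<le> r ^ i" using r2 by (rule power_mono) simp
  ultimately show False by simp
qed

section \<open>The three cases, and independence of \<open>l\<close>\<close>

theorem theorem2p5:
  fixes f :: "'p::prime_card padic poly" and l :: nat
    and s :: "nat \<Rightarrow> nat \<Rightarrow> 'p padic"
  assumes "1 \<le> l" and "f \<noteq> 0"
  defines "s \<equiv> \<lambda>l n. padic_reduced l (poly f (of_nat n))"
  shows
    "(padic_integer_roots f = {} \<longrightarrow> (\<forall>k\<ge>2. k_regular k (s l))) \<and>
     (padic_integer_roots f \<noteq> {} \<and> padic_integer_roots f \<subseteq> \<rat>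
        \<longrightarrow> strictly_k_regular CARD('p) (s l)) \<and>
     (\<not> padic_integer_roots f \<subseteq> \<rat> \<longrightarrow> \<not> regular (s l)) \<and>
     (\<forall>l'\<ge>1.
        ((\<forall>k\<ge>2. k_regular k (s l)) \<longleftrightarrow> (\<forall>k\<ge>2. k_regular k (s l'))) \<and>
        (strictly_k_regular CARD('p) (s l) \<longleftrightarrow> strictly_k_regular CARD('p) (s l')) \<and>
        (regular (s l) \<longleftrightarrow> regular (s l')))"
proof -
  let ?p = "CARD('p)" and ?R = "padic_integer_roots f"
  have R: "x \<in> ?R \<longleftrightarrow> padic_ge 0 x \<and> poly f x = 0" for x
    by (simp add: padic_integer_roots_def padic_integers_iff)
  have p2: "2 \<le> ?p" using CARD_prime_card_gt_1[where 'p = 'p] by simp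
  \<comment> \<open>The base \<open>p + 1\<close> is a concrete test case: it refutes regularity for
    all bases when there is a root, and strictness when there is none. A common power would make
    \<open>p\<close> divide 1.\<close>
  have indep: "mult_indep ?p (?p + 1)"
    unfolding mult_indep_def
  proof (intro allI impI notI)
    fix a c :: nat assume "1 \<le> a" and eq: "?p ^ a = (?p + 1) ^ c"
    then have "?p dvd (?p + 1) ^ c" by (metis dvd_power less_eq_Suc_le One_nat_def)
    then have "?p dvd ?p + 1" using prime_dvd_power[OF prime_card] by blast
    then have "?p dvd 1" using dvd_diff_nat[of ?p "?p + 1" ?p] by simp
    then show False using p2 by simp
  qed
  have none: "k_regular k (s l)" if "1 \<le> l" "?R = {}" "2 \<le> k" for l k
    unfolding s_def by (rule k_regular_reduced_poly) (use that assms(2) R in auto)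
  have rational: "k_regular ?p (s l)" if "1 \<le> l" "?R \<subseteq> \<rat>" for l
    unfolding s_def by (rule k_regular_reduced_poly) (use that assms(2) R p2 in auto)
  have irrational: "\<not> k_regular k (s l)" if "1 \<le> l" "\<not> ?R \<subseteq> \<rat>" for l k
    using that k_regular_roots_rational[OF that(1) assms(2)] R unfolding s_def by blast
  have base: "\<not> k_regular k (s l)" if "1 \<le> l" "?R \<noteq> {}" "mult_indep ?p k" for l k
    using that k_regular_root_base[OF that(1) assms(2)] R unfolding s_def by blast
  \<comment> \<open>Each of the three properties is shown equivalent to a condition on the roots
    alone, so it cannot depend on \<open>l\<close>.\<close>
  have all_iff: "(\<forall>k\<ge>2. k_regular k (s l)) \<longleftrightarrow> ?R = {}" if "1 \<le> l" for l
  proof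
    assume "\<forall>k\<ge>2. k_regular k (s l)"
    then have "k_regular (?p + 1) (s l)" using p2 by simp
    then show "?R = {}" using base[OF that _ indep] by blast
  qed (simp add: none[OF that])
  have strict_iff: "strictly_k_regular ?p (s l) \<longleftrightarrow> ?R \<noteq> {} \<and> ?R \<subseteq> \<rat>" if "1 \<le> l" for l
  proof
    assume strict: "strictly_k_regular ?p (s l)"
    then have "\<not> k_regular (?p + 1) (s l)" "k_regular ?p (s l)"
      using indep p2 by (auto simp: strictly_k_regular_def)
    then show "?R \<noteq> {} \<and> ?R \<subseteq> \<rat>" using none[OF that, of "?p + 1"] irrational[OF that] p2 by auto
  next
    assume "?R \<noteq> {} \<and> ?R \<subseteq> \<rat>"
    then show "strictly_k_regular ?p (s l)"
      using rational[OF that] base[OF that] by (simp add: strictly_k_regular_def)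
  qed
  have regular_iff: "regular (s l) \<longleftrightarrow> ?R \<subseteq> \<rat>" if "1 \<le> l" for l
    using rational[OF that] irrational[OF that] p2 unfolding regular_def by blast
  show ?thesis
    using all_iff strict_iff regular_iff assms(1) by simp
qed

end
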